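(* For every integer $n$, there is, up to equivalence, exactly one differential graded algebra of type $\beta_{\mathbb{Z}}(n)$, i.e. exactly one equivalence class of DGAs $A$ such that $H_*A$ is an exterior algebra over $\mathbb{Z}$ on a class of degree $n$.
   Context: A differential graded algebra (DGA) is a chain complex $A$ of abelian groups ($\mathbb{Z}$-graded, possibly unbounded, with differential of degree $-1$) together with a unital associative multiplication $A\otimes A\to A$ that is a chain map. A morphism of DGAs is a chain map respecting multiplication and unit; it is an equivalence if it induces isomorphisms on all homology groups. Two DGAs are equivalent if they are connected by a finite zig-zag of equivalences of DGAs. For a commutative ring $R$ and an integer $n$, a DGA $A$ is of type $\beta_R(n)$ if the graded ring $H_*A$ is isomorphic to the exterior algebra over $R$ on one class $x$ of degree $n$, that is, $R\oplus Rx$ with $|x|=n$, $x^2=0$, and $R$ in degree $0$. *)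

theory Defs
  imports "HOL-Algebra.IntRing"
begin

section \<open>Graded rings and differential graded algebras\<close>

text \<open>
  The abelian group in each degree is a commutative group of HOL-Algebra, and is therefore
  written multiplicatively, as HOL-Homology does for homology groups: the operation
  \<open>\<otimes>\<close> of \<open>component A k\<close> is the addition of \<open>A\<close> in degree \<open>k\<close>, its \<open>\<one>\<close> is zero, and
  \<open>inv\<close> is negation.  The ring multiplication is the separate operation
  \<open>gmult A p q\<close>, from degrees \<open>p\<close> and \<open>q\<close> to degree \<open>p + q\<close>.  The components need not be
  disjoint as sets.
\<close>

record 'a graded_ring =
  component :: "int \<Rightarrow> 'a monoid"
  gmult :: "int \<Rightarrow> int \<Rightarrow> 'a \<Rightarrow> 'a \<Rightarrow> 'a"
  gunit :: 'a

record 'a dga = "'a graded_ring" +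
  diff :: "int \<Rightarrow> 'a \<Rightarrow> 'a"

locale graded_ring =
  fixes A :: "('a, 'm) graded_ring_scheme"
  assumes comm_group_component: "comm_group (component A k)"
    and gmult_hom_right: "x \<in> carrier (component A p) \<Longrightarrow>
      gmult A p q x \<in> hom (component A q) (component A (p + q))"
    and gmult_hom_left: "y \<in> carrier (component A q) \<Longrightarrow>
      (\<lambda>x. gmult A p q x y) \<in> hom (component A p) (component A (p + q))"
    and gmult_assoc: "\<lbrakk>x \<in> carrier (component A p); y \<in> carrier (component A q);
        z \<in> carrier (component A r)\<rbrakk> \<Longrightarrow>
      gmult A (p + q) r (gmult A p q x y) z = gmult A p (q + r) x (gmult A q r y z)"
    and gunit_closed: "gunit A \<in> carrier (component A 0)"
    and gunit_left: "x \<in> carrier (component A p) \<Longrightarrow> gmult A 0 p (gunit A) x = x"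
    and gunit_right: "x \<in> carrier (component A p) \<Longrightarrow> gmult A p 0 x (gunit A) = x"

text \<open>
  The axiom \<open>leibniz\<close> reads \<open>d (x y) = (d x) y + (-1)^p x (d y)\<close>; together with biadditivity it
  says that the multiplication is a chain map on the tensor product.  It also implies that the
  unit is a cycle.
\<close>

locale dga = graded_ring A for A :: "('a, 'm) dga_scheme" +
  assumes diff_hom: "diff A k \<in> hom (component A k) (component A (k - 1))"
    and diff_diff: "x \<in> carrier (component A k) \<Longrightarrow>
      diff A (k - 1) (diff A k x) = \<one>\<^bsub>component A (k - 1 - 1)\<^esub>"
    and leibniz: "\<lbrakk>x \<in> carrier (component A p); y \<in> carrier (component A q)\<rbrakk> \<Longrightarrow>
      diff A (p + q) (gmult A p q x y) =
        gmult A (p - 1) q (diff A p x) y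
          \<otimes>\<^bsub>component A (p + q - 1)\<^esub>
        (if even p then gmult A p (q - 1) x (diff A q y)
         else inv\<^bsub>component A (p + q - 1)\<^esub> gmult A p (q - 1) x (diff A q y))"

definition graded_ring_isomorphic ::
    "('a, 'm) graded_ring_scheme \<Rightarrow> ('b, 'n) graded_ring_scheme \<Rightarrow> bool" where
  "graded_ring_isomorphic A B \<longleftrightarrow>
    (\<exists>f. (\<forall>k. f k \<in> iso (component A k) (component B k)) \<and>
         (\<forall>p q. \<forall>x \<in> carrier (component A p). \<forall>y \<in> carrier (component A q).
            f (p + q) (gmult A p q x y) = gmult B p q (f p x) (f q y)) \<and>
         f 0 (gunit A) = gunit B)"

section \<open>Homology\<close>

definition cycles :: "('a, 'm) dga_scheme \<Rightarrow> int \<Rightarrow> 'a set" where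
  "cycles A k = kernel (component A k) (component A (k - 1)) (diff A k)"

definition boundaries :: "('a, 'm) dga_scheme \<Rightarrow> int \<Rightarrow> 'a set" where
  "boundaries A k = diff A (k + 1) ` carrier (component A (k + 1))"

definition homology :: "('a, 'm) dga_scheme \<Rightarrow> int \<Rightarrow> 'a set monoid" where
  "homology A k = (component A k)\<lparr>carrier := cycles A k\<rparr> Mod boundaries A k"

definition homology_class :: "('a, 'm) dga_scheme \<Rightarrow> int \<Rightarrow> 'a \<Rightarrow> 'a set" where
  "homology_class A k z = boundaries A k #>\<^bsub>component A k\<^esub> z"

text \<open>
  Here and in \<open>homology_map\<close> below, \<open>the_elem\<close> picks the common homology class of all results
  obtained from representing cycles.
\<close>

definition homology_ring :: "('a, 'm) dga_scheme \<Rightarrow> 'a set graded_ring" where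
  "homology_ring A =
    \<lparr>component = homology A,
     gmult = (\<lambda>p q C D.
       the_elem ((\<lambda>(x, y). homology_class A (p + q) (gmult A p q x y)) ` (C \<times> D))),
     gunit = homology_class A 0 (gunit A)\<rparr>"

definition homology_map ::
    "('b, 'n) dga_scheme \<Rightarrow> (int \<Rightarrow> 'a \<Rightarrow> 'b) \<Rightarrow> int \<Rightarrow> 'a set \<Rightarrow> 'b set" where
  "homology_map B f k C = the_elem ((\<lambda>x. homology_class B k (f k x)) ` C)"

section \<open>Morphisms and equivalence\<close>

definition dga_hom ::
    "('a, 'm) dga_scheme \<Rightarrow> ('b, 'n) dga_scheme \<Rightarrow> (int \<Rightarrow> 'a \<Rightarrow> 'b) set" where
  "dga_hom A B =
    {f. (\<forall>k. f k \<in> hom (component A k) (component B k)) \<and>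
        (\<forall>k. \<forall>x \<in> carrier (component A k). f (k - 1) (diff A k x) = diff B k (f k x)) \<and>
        (\<forall>p q. \<forall>x \<in> carrier (component A p). \<forall>y \<in> carrier (component A q).
           f (p + q) (gmult A p q x y) = gmult B p q (f p x) (f q y)) \<and>
        f 0 (gunit A) = gunit B}"

definition dga_equivalence ::
    "('a, 'm) dga_scheme \<Rightarrow> ('b, 'n) dga_scheme \<Rightarrow> (int \<Rightarrow> 'a \<Rightarrow> 'b) \<Rightarrow> bool" where
  "dga_equivalence A B f \<longleftrightarrow>
    f \<in> dga_hom A B \<and> (\<forall>k. homology_map B f k \<in> iso (homology A k) (homology B k))"

text \<open>
  All objects of a zig-zag have their elements in the same type \<open>'a\<close>, which plays the role of
  the universe of discourse.  DGAs with elements in different types are compared after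
  transporting them into a type that contains both.
\<close>

definition dga_equivalent :: "'a dga \<Rightarrow> 'a dga \<Rightarrow> bool" where
  "dga_equivalent = equivclp (\<lambda>A B. dga A \<and> dga B \<and> (\<exists>f. dga_equivalence A B f))"

section \<open>DGAs with exterior homology\<close>

text \<open>
  The pair \<open>(a, b)\<close> stands for \<open>a + b x\<close> with \<open>x\<close> of degree \<open>n\<close> and \<open>x\<^sup>2 = 0\<close>.  This covers
  \<open>n = 0\<close>, where degree \<open>0\<close> is all of \<open>R \<oplus> R x\<close>.
\<close>

definition exterior_algebra :: "'r ring \<Rightarrow> int \<Rightarrow> ('r \<times> 'r) graded_ring" where
  "exterior_algebra R n =
    \<lparr>component = (\<lambda>k. (add_monoid R \<times>\<times> add_monoid R)
       \<lparr>carrier := {(a, b). a \<in> carrier R \<and> b \<in> carrier R \<and>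
          (k \<noteq> 0 \<longrightarrow> a = \<zero>\<^bsub>R\<^esub>) \<and> (k \<noteq> n \<longrightarrow> b = \<zero>\<^bsub>R\<^esub>)}\<rparr>),
     gmult = (\<lambda>p q (a, b) (c, d). (a \<otimes>\<^bsub>R\<^esub> c, a \<otimes>\<^bsub>R\<^esub> d \<oplus>\<^bsub>R\<^esub> b \<otimes>\<^bsub>R\<^esub> c)),
     gunit = (\<one>\<^bsub>R\<^esub>, \<zero>\<^bsub>R\<^esub>)\<rparr>"

definition of_type_beta :: "'r ring \<Rightarrow> int \<Rightarrow> ('a, 'm) dga_scheme \<Rightarrow> bool" where
  "of_type_beta R n A \<longleftrightarrow> graded_ring_isomorphic (homology_ring A) (exterior_algebra R n)"

end

theory Submission
  imports Defs "HOL-Algebra.Free_Abelian_Groups"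
begin

text \<open>
  The free graded ring \<open>C\<close> on letters \<open>x\<^sub>1, x\<^sub>2, \<dots>\<close> with \<open>|x\<^sub>k| = k n + k - 1\<close>
  and \<open>d x\<^sub>k = \<Sum> \<plusminus> x\<^sub>i x\<^sub>j\<close> over \<open>i + j = k\<close> (the cobar-bar resolution of the exterior
  algebra) has exterior homology generated by \<open>x\<^sub>1\<close>: merging a leading \<open>x\<^sub>1\<close> with the next letter
  is a contracting homotopy away from the words \<open>1\<close> and \<open>x\<^sub>1\<close>.  For any \<open>B\<close> of type
  \<open>\<beta>(n)\<close> a ring map \<open>C \<rightarrow> B\<close> sending \<open>x\<^sub>1\<close> to a generator is built letter by letter.  The
  obstruction to choosing the image of \<open>x\<^sub>k\<close> is a class of degree \<open>k (n + 1) - 2\<close>; for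
  \<open>k = 2\<close> it is \<open>\<plusminus> x\<^sup>2 = 0\<close>, and for \<open>k \<ge> 3\<close> that degree is neither \<open>0\<close> nor \<open>n\<close>.
  So \<open>C\<close>, copied into \<open>'u\<close>, maps by an equivalence to every such \<open>B\<close>.
\<close>

section \<open>The free ring on the letters and its differential\<close>

text \<open>The exterior algebra itself cannot serve as the source: in a DGA of type beta the square
  of a representing cycle is only known to be a boundary, so there need be no ring map out of the
  exterior algebra. A source that is free as a ring is needed, in which \<open>x_2\<close> records
  why the square bounds, \<open>x_3\<close> why the resulting triple Massey product vanishes, and so
  on. The letter \<open>x_k\<close> is the desuspension of the bar word \<open>[x|...|x]\<close>
  with \<open>k\<close> entries, each of degree \<open>n + 1\<close>; this explains its degree
  \<open>k (n + 1) - 1\<close>, and its differential is the deconcatenation of that word. The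
  obstructions for \<open>k \<ge> 3\<close> vanish by divisibility: degree 0 would mean
  \<open>k (n + 1) = 2\<close>, so that \<open>k\<close> divides 2, and degree \<open>n\<close>
  would mean \<open>(k - 1) (n + 1) = 1\<close>, so that \<open>k - 1\<close> divides 1. No sign or
  size of \<open>n\<close> enters, which is why one argument covers every integer. For
  \<open>n = 0\<close> the unit and the generator share a degree; they are told apart as words, not
  by degree.\<close>

text \<open>With this instance the product of \<open>Poly_Mapping\<close> makes \<open>'a list \<Rightarrow>\<^sub>0 int\<close> the free ring on \<open>'a\<close>.\<close>

instantiation list :: (type) monoid_add
begin

definition zero_list :: "'a list" where "zero_list = []"

definition plus_list :: "'a list \<Rightarrow> 'a list \<Rightarrow> 'a list" where "plus_list = (@)"

instance
  by intro_classes (simp_all add: zero_list_def plus_list_def)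

end

lemma frag_of_mult_frag_of: "frag_of u * frag_of v = frag_of (u @ v)"
  by (simp add: mult_single plus_list_def)

lemma one_eq_frag_of_Nil: "1 = frag_of []"
  unfolding zero_list_def[symmetric] by (simp add: single_one)

text \<open>The Koszul sign \<open>(-1)^k\<close>. The exponent is an integer because degrees may be
  negative; only its parity is read.\<close>

definition signed :: "int \<Rightarrow> 'a::ab_group_add \<Rightarrow> 'a" where
  "signed k x = (if even k then x else - x)"

lemma signed_simps [simp]:
  "signed k 0 = 0"
  "signed k (signed l x) = signed (k + l) x"
  by (auto simp: signed_def)

lemma signed_mult [simp]:
  fixes x y :: "'a::ring"
  shows "signed k x * y = signed k (x * y)" "x * signed k y = signed k (x * y)"
  by (auto simp: signed_def)

lemma signed_add: "signed k (x + y) = signed k x + signed k y"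
  by (auto simp: signed_def)

lemma signed_sum: "signed k (\<Sum>i\<in>I. f i) = (\<Sum>i\<in>I. signed k (f i))"
  by (auto simp: signed_def sum_negf)

lemma frag_extend_signed: "frag_extend f (signed k x) = signed k (frag_extend f x)"
  by (auto simp: signed_def frag_extend_minus)

lemma keys_signed [simp]: "Poly_Mapping.keys (signed k x) = Poly_Mapping.keys x"
  by (auto simp: signed_def)

lemma lookup_signed [simp]: "Poly_Mapping.lookup (signed k x) w = signed k (Poly_Mapping.lookup x w)"
  by (simp add: signed_def lookup_uminus)

text \<open>Linearity reduces an identity to words. Additivity is asked on the whole type, so that
  no support conditions arise from it; the support enters only through \<open>S\<close>, which
  limits the words to be checked.\<close>

lemma additive_eq_on_frag_of:
  fixes f g :: "('a \<Rightarrow>\<^sub>0 int) \<Rightarrow> 'b::ab_group_add"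
  assumes "Poly_Mapping.keys x \<subseteq> S"
    and "\<And>x y. f (x + y) = f x + f y"
    and "\<And>x y. g (x + y) = g x + g y"
    and "\<And>w. w \<in> S \<Longrightarrow> f (frag_of w) = g (frag_of w)"
  shows "f x = g x"
proof -
  have diff: "h (x - y) = h x - h y" if "\<And>x y. h (x + y) = h x + h y"
    for h :: "('a \<Rightarrow>\<^sub>0 int) \<Rightarrow> 'b" and x y
    using that[of "x - y" y] by (simp add: eq_diff_eq)
  have zero: "h 0 = 0" if "\<And>x y. h (x + y) = h x + h y"
    for h :: "('a \<Rightarrow>\<^sub>0 int) \<Rightarrow> 'b"
    using that[of 0 0] by simp
  show ?thesis
    using assms(1)
    by (induction rule: frag_induction)
      (simp_all add: assms(4) diff[of f, OF assms(2)] diff[of g, OF assms(3)]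
        zero[of f, OF assms(2)] zero[of g, OF assms(3)])
qed

text \<open>The letter \<open>i\<close> stands for \<open>x\<^sub>i\<^sub>+\<^sub>1\<close>.\<close>

definition letter_degree :: "int \<Rightarrow> nat \<Rightarrow> int" where
  "letter_degree n i = (int i + 1) * (n + 1) - 1"

definition word_degree :: "int \<Rightarrow> nat list \<Rightarrow> int" where
  "word_degree n w = (\<Sum>i\<leftarrow>w. letter_degree n i)"

lemma word_degree_simps [simp]:
  "word_degree n [] = 0"
  "word_degree n (i # w) = letter_degree n i + word_degree n w"
  "word_degree n (u @ v) = word_degree n u + word_degree n v"
  by (simp_all add: word_degree_def)

lemma letter_degree_split:
  "i < k \<Longrightarrow> letter_degree n i + letter_degree n (k - 1 - i) = letter_degree n k - 1"
  by (simp add: letter_degree_def of_nat_diff algebra_simps)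

lemma letter_degree_Suc: "letter_degree n (Suc i) = letter_degree n i + n + 1"
  by (simp add: letter_degree_def algebra_simps)

section \<open>Homogeneous elements and the differential\<close>

abbreviation words :: "int \<Rightarrow> int \<Rightarrow> nat list set" where
  "words n p \<equiv> {w. word_degree n w = p}"

text \<open>Since letter \<open>i\<close> is \<open>x_(i+1)\<close>, the indices in a summand add up
  to \<open>k - 1\<close>, and letter 0 has zero differential. The sign is the parity of
  \<open>(i + 1) (n + 1)\<close>, the degree of the first letter before desuspension.\<close>

definition diff_letter :: "int \<Rightarrow> nat \<Rightarrow> nat list \<Rightarrow>\<^sub>0 int" where
  "diff_letter n k = (\<Sum>i<k. signed (letter_degree n i + 1) (frag_of [i, k - 1 - i]))"

fun diff_word :: "int \<Rightarrow> nat list \<Rightarrow> nat list \<Rightarrow>\<^sub>0 int" where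
  "diff_word n [] = 0"
| "diff_word n (k # w) =
     diff_letter n k * frag_of w + signed (letter_degree n k) (frag_of [k] * diff_word n w)"

definition free_diff :: "int \<Rightarrow> (nat list \<Rightarrow>\<^sub>0 int) \<Rightarrow> nat list \<Rightarrow>\<^sub>0 int" where
  "free_diff n = frag_extend (diff_word n)"

lemma free_diff_add: "free_diff n (x + y) = free_diff n x + free_diff n y"
  by (simp add: free_diff_def frag_extend_add)

lemma free_diff_simps [simp]:
  "free_diff n 0 = 0"
  "free_diff n (frag_of w) = diff_word n w"
  "free_diff n (signed k x) = signed k (free_diff n x)"
  by (simp_all add: free_diff_def frag_extend_signed)

lemma free_diff_sum: "finite I \<Longrightarrow> free_diff n (\<Sum>i\<in>I. f i) = (\<Sum>i\<in>I. free_diff n (f i))"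
  by (simp add: free_diff_def frag_extend_sum)

text \<open>All degrees share one type, so that homogeneity of degree \<open>p\<close> is a support
  condition: every word that occurs lies in \<open>words n p\<close>.\<close>

lemma keys_mult_words:
  assumes "Poly_Mapping.keys x \<subseteq> words n p" "Poly_Mapping.keys y \<subseteq> words n q"
  shows "Poly_Mapping.keys (x * y) \<subseteq> words n (p + q)"
  using keys_mult[of x y] assms by (fastforce simp: plus_list_def)

lemma keys_add_subset:
  "\<lbrakk>Poly_Mapping.keys x \<subseteq> S; Poly_Mapping.keys y \<subseteq> S\<rbrakk> \<Longrightarrow> Poly_Mapping.keys (x + y) \<subseteq> S"
  using keys_add[of x y] by blast

lemma keys_frag_extend_subset:
  assumes "\<And>w. w \<in> Poly_Mapping.keys x \<Longrightarrow> Poly_Mapping.keys (f w) \<subseteq> S"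
  shows "Poly_Mapping.keys (frag_extend f x) \<subseteq> S"
  using keys_frag_extend assms by (rule order_trans[OF _ UN_least])

lemma keys_diff_letter: "Poly_Mapping.keys (diff_letter n k) \<subseteq> words n (letter_degree n k - 1)"
proof -
  have "Poly_Mapping.keys (diff_letter n k)
      \<subseteq> (\<Union>i<k. Poly_Mapping.keys (signed (letter_degree n i + 1) (frag_of [i, k - 1 - i])))"
    unfolding diff_letter_def by (rule keys_sum)
  also have "\<dots> \<subseteq> words n (letter_degree n k - 1)"
    using letter_degree_split by (auto simp: keys_frag_of)
  finally show ?thesis .
qed

lemma keys_diff_word: "Poly_Mapping.keys (diff_word n w) \<subseteq> words n (word_degree n w - 1)"
proof (induction w)
  case (Cons k w)
  have "Poly_Mapping.keys (diff_letter n k * frag_of w)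
      \<subseteq> words n (letter_degree n k - 1 + word_degree n w)"
    by (rule keys_mult_words[OF keys_diff_letter]) (simp add: keys_frag_of)
  moreover have "Poly_Mapping.keys (frag_of [k] * diff_word n w)
      \<subseteq> words n (letter_degree n k + (word_degree n w - 1))"
    by (rule keys_mult_words[OF _ Cons.IH]) (simp add: keys_frag_of)
  ultimately show ?case
    by (simp add: algebra_simps keys_add_subset)
qed simp

lemma keys_free_diff:
  assumes "Poly_Mapping.keys x \<subseteq> words n p"
  shows "Poly_Mapping.keys (free_diff n x) \<subseteq> words n (p - 1)"
  unfolding free_diff_def using keys_diff_word[of n] assms by (intro keys_frag_extend_subset) blast

section \<open>The Leibniz rule and the square of the differential\<close>

lemma diff_word_append:
  "diff_word n (u @ v) =
     diff_word n u * frag_of v + signed (word_degree n u) (frag_of u * diff_word n v)"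
proof (induction u)
  case Nil
  then show ?case by (simp add: signed_def flip: one_eq_frag_of_Nil)
next
  case (Cons k u)
  have "frag_of (k # u) = frag_of [k] * frag_of u"
    by (simp add: frag_of_mult_frag_of)
  moreover have "frag_of (u @ v) = frag_of u * frag_of v"
    by (simp add: frag_of_mult_frag_of)
  ultimately show ?case
    by (simp add: Cons.IH signed_add distrib_left distrib_right mult.assoc add.assoc)
qed

text \<open>Only \<open>x\<close> has to be homogeneous, because the sign depends on the degree of
  the first factor alone.\<close>

lemma free_diff_mult:
  assumes "Poly_Mapping.keys x \<subseteq> words n p"
  shows "free_diff n (x * y) = free_diff n x * y + signed p (x * free_diff n y)"
  using assms
proof (rule additive_eq_on_frag_of)
  fix u :: "nat list" assume u: "u \<in> words n p"
  have "Poly_Mapping.keys y \<subseteq> UNIV" by simp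
  then show "free_diff n (frag_of u * y)
      = free_diff n (frag_of u) * y + signed p (frag_of u * free_diff n y)"
    by (rule additive_eq_on_frag_of)
      (use u in \<open>simp_all add: frag_of_mult_frag_of diff_word_append free_diff_add signed_add algebra_simps\<close>)
qed (simp_all add: free_diff_add signed_add algebra_simps)

text \<open>Every three-letter word with index sum \<open>k - 2\<close> arises twice, from splitting
  the first or the second letter of a summand \<open>[i, k - 1 - i]\<close>, and the two occurrences
  have opposite signs.\<close>

lemma free_diff_diff_letter: "free_diff n (diff_letter n k) = 0"
proof -
  define m where "m = n + 1"
  let ?w = "\<lambda>a b. frag_of [a, b, k - 2 - a - b]"
  have dl: "diff_word n [i, j] = diff_letter n i * frag_of [j]
      + signed (letter_degree n i) (frag_of [i] * diff_letter n j)" for i j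
    by (simp flip: one_eq_frag_of_Nil)
  have "free_diff n (diff_letter n k)
      = (\<Sum>i<k. signed (letter_degree n i + 1) (diff_letter n i * frag_of [k - 1 - i]))
      + (\<Sum>i<k. signed (letter_degree n i + 1 + letter_degree n i)
           (frag_of [i] * diff_letter n (k - 1 - i)))"
    by (subst diff_letter_def)
      (simp add: free_diff_sum dl signed_add sum.distrib del: diff_word.simps)
  also have "(\<Sum>i<k. signed (letter_degree n i + 1) (diff_letter n i * frag_of [k - 1 - i]))
      = (\<Sum>i<k. \<Sum>j<i. signed (letter_degree n i + letter_degree n j)
           (frag_of [j, i - 1 - j, k - 1 - i]))"
    by (simp add: diff_letter_def sum_distrib_right frag_of_mult_frag_of signed_sum)
      (simp add: signed_def)
  also have "\<dots> = (\<Sum>(i, j)\<in>Sigma {..<k} (\<lambda>i. {..<i}).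
      signed (letter_degree n i + letter_degree n j) (frag_of [j, i - 1 - j, k - 1 - i]))"
    by (simp add: sum.Sigma)
  also have "\<dots> = (\<Sum>(i, j)\<in>Sigma {..<k} (\<lambda>i. {..<k - 1 - i}).
      - signed (letter_degree n j) (frag_of [i, j, k - 1 - i - 1 - j]))"
  \<comment> \<open>The pair of splitting points \<open>(i, j)\<close> becomes the pair
    \<open>(j, i - 1 - j)\<close> of the first two letters of the word.\<close>
  proof (rule sum.reindex_bij_witness[of _ "\<lambda>(a, b). (a + b + 1, a)" "\<lambda>(i, j). (j, i - 1 - j)"])
    fix p assume "p \<in> Sigma {..<k} (\<lambda>i. {..<i})"
    then obtain i j where p: "p = (i, j)" "i < k" "j < i" by auto
    \<comment> \<open>Splitting a letter costs one degree, and this off-by-one makes the two signs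
      opposite.\<close>
    have "letter_degree n i + letter_degree n j
        = letter_degree n (i - 1 - j) + 1 + 2 * letter_degree n j"
      using letter_degree_split[OF p(3), of n] by simp
    then have "signed (letter_degree n i + letter_degree n j) x = - signed (letter_degree n (i - 1 - j)) x"
      for x :: "nat list \<Rightarrow>\<^sub>0 int"
      by (simp add: signed_def)
    moreover have "k - 1 - j - 1 - (i - 1 - j) = k - 1 - i"
      using p by auto
    ultimately show "(case (case p of (i, j) \<Rightarrow> (j, i - 1 - j)) of (i, j) \<Rightarrow>
        - signed (letter_degree n j) (frag_of [i, j, k - 1 - i - 1 - j])) =
        (case p of (i, j) \<Rightarrow> signed (letter_degree n i + letter_degree n j)
          (frag_of [j, i - 1 - j, k - 1 - i]))"
      using p by simp
  qed auto
  also have "\<dots> = - (\<Sum>i<k. \<Sum>j<k - 1 - i. signed (letter_degree n j)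
      (frag_of [i, j, k - 1 - i - 1 - j]))"
    by (simp add: sum.Sigma sum_negf split_beta)
  also have "(\<Sum>i<k. \<Sum>j<k - 1 - i. signed (letter_degree n j)
      (frag_of [i, j, k - 1 - i - 1 - j] :: nat list \<Rightarrow>\<^sub>0 int))
    = (\<Sum>i<k. signed (letter_degree n i + 1 + letter_degree n i)
           (frag_of [i] * diff_letter n (k - 1 - i)))"
    by (simp add: diff_letter_def sum_distrib_left frag_of_mult_frag_of signed_sum)
      (simp add: signed_def)
  finally show ?thesis by simp
qed

text \<open>By the Leibniz rule only the two mixed terms
  \<open>diff_letter n k * diff_word n w\<close> remain; the exponents of their signs are
  \<open>letter_degree n k - 1\<close> and \<open>letter_degree n k\<close>.\<close>

lemma free_diff_diff_word: "free_diff n (diff_word n w) = 0"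
proof (induction w)
  case (Cons k w)
  have "free_diff n (diff_letter n k * frag_of w)
      = signed (letter_degree n k - 1) (diff_letter n k * diff_word n w)"
    by (simp add: free_diff_mult[OF keys_diff_letter] free_diff_diff_letter)
  moreover have "free_diff n (frag_of [k] * diff_word n w) = diff_letter n k * diff_word n w"
    by (subst free_diff_mult[where p = "letter_degree n k"])
      (simp_all add: keys_frag_of Cons.IH flip: one_eq_frag_of_Nil)
  ultimately show ?case
    by (simp add: free_diff_add) (simp add: signed_def)
qed simp

lemma free_diff_free_diff: "free_diff n (free_diff n x) = 0"
proof -
  have "Poly_Mapping.keys x \<subseteq> UNIV" by simp
  then show ?thesis
    by (rule additive_eq_on_frag_of[where g = "\<lambda>_. 0"])
      (simp_all add: free_diff_add free_diff_diff_word)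
qed

text \<open>The contracting homotopy; \<open>[0]\<close> is the class \<open>x\<^sub>1\<close>.\<close>

fun merge_word :: "int \<Rightarrow> nat list \<Rightarrow> nat list \<Rightarrow>\<^sub>0 int" where
  "merge_word n (0 # k # w) = signed (n + 1) (frag_of (Suc k # w))"
| "merge_word n _ = 0"

definition merge :: "int \<Rightarrow> (nat list \<Rightarrow>\<^sub>0 int) \<Rightarrow> nat list \<Rightarrow>\<^sub>0 int" where
  "merge n = frag_extend (merge_word n)"

text \<open>What a leading letter 0 does to the rest of a word under \<open>merge\<close>, up to
  sign: it is absorbed by the next letter. The empty word goes to 0 because \<open>[0]\<close> has
  no next letter to merge with.\<close>

definition raise :: "(nat list \<Rightarrow>\<^sub>0 int) \<Rightarrow> nat list \<Rightarrow>\<^sub>0 int" where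
  "raise = frag_extend (\<lambda>w. case w of [] \<Rightarrow> 0 | k # w \<Rightarrow> frag_of (Suc k # w))"

lemma merge_add: "merge n (x + y) = merge n x + merge n y"
  by (simp add: merge_def frag_extend_add)

lemma merge_simps [simp]:
  "merge n 0 = 0"
  "merge n (frag_of w) = merge_word n w"
  "merge n (signed k x) = signed k (merge n x)"
  by (simp_all add: merge_def frag_extend_signed)

lemma merge_sum: "finite I \<Longrightarrow> merge n (\<Sum>i\<in>I. f i) = (\<Sum>i\<in>I. merge n (f i))"
  by (simp add: merge_def frag_extend_sum)

lemma raise_add: "raise (x + y) = raise x + raise y"
  by (simp add: raise_def frag_extend_add)

lemma raise_simps [simp]:
  "raise 0 = 0"
  "raise (frag_of []) = 0"
  "raise (frag_of (k # w)) = frag_of (Suc k # w)"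
  "raise (signed l x) = signed l (raise x)"
  by (simp_all add: raise_def frag_extend_signed)

lemma raise_sum: "finite I \<Longrightarrow> raise (\<Sum>i\<in>I. f i) = (\<Sum>i\<in>I. raise (f i))"
  by (simp add: raise_def frag_extend_sum)

lemma raise_letter_mult: "raise (frag_of [k] * y) = frag_of [Suc k] * y"
proof -
  have "Poly_Mapping.keys y \<subseteq> UNIV" by simp
  then show ?thesis
    by (rule additive_eq_on_frag_of) (simp_all add: distrib_left raise_add frag_of_mult_frag_of)
qed

lemma merge_letter_mult:
  "merge n (frag_of [k] * y) = (if k = 0 then signed (n + 1) (raise y) else 0)"
proof -
  have "Poly_Mapping.keys y \<subseteq> UNIV" by simp
  then show ?thesis
  proof (rule additive_eq_on_frag_of[where f = "\<lambda>y. merge n (frag_of [k] * y)"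
        and g = "\<lambda>y. if k = 0 then signed (n + 1) (raise y) else 0"])
    fix w :: "nat list"
    show "merge n (frag_of [k] * frag_of w) = (if k = 0 then signed (n + 1) (raise (frag_of w)) else 0)"
      by (cases k; cases w) (simp_all add: frag_of_mult_frag_of)
  qed (auto simp: distrib_left raise_add merge_add signed_add)
qed

lemma keys_merge:
  assumes "Poly_Mapping.keys x \<subseteq> words n p"
  shows "Poly_Mapping.keys (merge n x) \<subseteq> words n (p + 1)"
proof -
  have "Poly_Mapping.keys (merge_word n w) \<subseteq> words n (word_degree n w + 1)" for w
  proof (cases "merge_word n w = 0")
    case False
    then obtain k v where "w = 0 # k # v"
      by (cases "(n, w)" rule: merge_word.cases) auto
    then show ?thesis
      by (simp add: keys_frag_of letter_degree_def algebra_simps)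
  qed simp
  then show ?thesis
    unfolding merge_def using assms by (intro keys_frag_extend_subset) blast
qed

text \<open>Only the summand \<open>i = 0\<close> of the differential begins with the letter 0. Its
  sign has exponent \<open>n + 1\<close>, the same as in \<open>merge_word\<close>, and the two
  cancel.\<close>

lemma merge_diff_letter_Suc_mult:
  "merge n (diff_letter n (Suc k) * frag_of w) = frag_of (Suc k # w)"
proof -
  have "merge n (diff_letter n (Suc k) * frag_of w)
      = (\<Sum>i<Suc k. signed (letter_degree n i + 1) (merge_word n (i # (k - i) # w)))"
    by (simp add: diff_letter_def sum_distrib_right frag_of_mult_frag_of merge_sum
        del: sum.lessThan_Suc)
  also have "\<dots> = (\<Sum>i\<in>{0}. signed (letter_degree n i + 1) (merge_word n (i # (k - i) # w)))"
  proof (rule sum.mono_neutral_right)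
    show "\<forall>i\<in>{..<Suc k} - {0}. signed (letter_degree n i + 1) (merge_word n (i # (k - i) # w)) = 0"
    proof
      fix i assume "i \<in> {..<Suc k} - {0}"
      then obtain j where "i = Suc j" by (cases i) auto
      then show "signed (letter_degree n i + 1) (merge_word n (i # (k - i) # w)) = 0" by simp
    qed
  qed auto
  also have "\<dots> = frag_of (Suc k # w)"
    by (simp add: letter_degree_def) (simp add: signed_def)
  finally show ?thesis .
qed

text \<open>A recursion for the differential along the index of the letter, used to differentiate a
  merged word. The summand \<open>i = 0\<close> is split off; in the others the first index drops by
  one, which changes its degree by \<open>n + 1\<close> and makes that sign a common factor.\<close>

lemma diff_letter_Suc_mult_word:
  "diff_letter n (Suc k) * frag_of w
    = signed (n + 1) (frag_of (0 # k # w) + raise (diff_letter n k * frag_of w))"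
proof -
  have "signed (letter_degree n (Suc i) + 1) (frag_of (Suc i # (k - Suc i) # w))
      = signed (n + 1 + (letter_degree n i + 1))
          (frag_of (Suc i # (k - 1 - i) # w) :: nat list \<Rightarrow>\<^sub>0 int)" for i
    by (simp add: letter_degree_Suc) (simp add: signed_def)
  then have "diff_letter n (Suc k) * frag_of w = signed (n + 1) (frag_of (0 # k # w))
     + (\<Sum>i<k. signed (n + 1 + (letter_degree n i + 1)) (frag_of (Suc i # (k - 1 - i) # w)))"
    by (simp add: diff_letter_def sum_distrib_right frag_of_mult_frag_of sum.lessThan_Suc_shift
        distrib_right del: sum.lessThan_Suc) (simp add: letter_degree_def)
  moreover have "signed (n + 1) (raise (diff_letter n k * frag_of w))
      = (\<Sum>i<k. signed (n + 1 + (letter_degree n i + 1)) (frag_of (Suc i # (k - 1 - i) # w)))"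
    by (simp add: diff_letter_def sum_distrib_right frag_of_mult_frag_of raise_sum signed_sum)
  ultimately show ?thesis
    by (simp add: signed_add)
qed

text \<open>A word with a positive first letter is killed by \<open>merge\<close> and recovered by
  merging its differential. For \<open>0 # k # v\<close>, differentiating the merged word gives the
  word plus an error term, and merging its differential gives the negative of that error. On
  \<open>[]\<close> and \<open>[0]\<close> both composites vanish, which is what the right-hand side
  accounts for.\<close>

lemma free_diff_merge:
  "free_diff n (merge n x) + merge n (free_diff n x)
    = x - frag_cmul (Poly_Mapping.lookup x []) (frag_of [])
        - frag_cmul (Poly_Mapping.lookup x [0]) (frag_of [0])"
proof -
  have "Poly_Mapping.keys x \<subseteq> UNIV" by simp
  then show ?thesis
  proof (rule additive_eq_on_frag_of)
    fix w :: "nat list"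
    consider "w = []" | "w = [0]" | k v where "w = Suc k # v" | k v where "w = 0 # k # v"
      by (metis list.exhaust nat.exhaust)
    then show "free_diff n (merge n (frag_of w)) + merge n (free_diff n (frag_of w))
      = frag_of w - frag_cmul (Poly_Mapping.lookup (frag_of w) []) (frag_of [])
          - frag_cmul (Poly_Mapping.lookup (frag_of w) [0]) (frag_of [0])"
    proof cases
      case 3
      then show ?thesis
        by (simp add: merge_add merge_diff_letter_Suc_mult merge_letter_mult)
    next
      case 4
      have "diff_letter n 0 = 0" by (simp add: diff_letter_def)
      then have "merge n (diff_word n w) = signed (letter_degree n 0 + (n + 1))
          (raise (diff_letter n k * frag_of v)
            + signed (letter_degree n k) (frag_of [Suc k] * diff_word n v))"
        using 4 by (simp add: merge_letter_mult raise_add raise_letter_mult)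
      moreover have "free_diff n (merge_word n w) = signed (n + 1)
          (signed (n + 1) (frag_of (0 # k # v) + raise (diff_letter n k * frag_of v))
           + signed (letter_degree n (Suc k)) (frag_of [Suc k] * diff_word n v))"
        using 4 by (simp add: diff_letter_Suc_mult_word)
      ultimately show ?thesis
        using 4 by (simp add: letter_degree_Suc signed_add)
          (simp add: letter_degree_def signed_def)
    qed (simp_all add: diff_letter_def)
  qed (simp_all add: free_diff_add merge_add lookup_add frag_cmul_distrib)
qed

section \<open>Homology of differential graded algebras\<close>

abbreviation cycle_group :: "('a, 'm) dga_scheme \<Rightarrow> int \<Rightarrow> 'a monoid" where
  "cycle_group A k \<equiv> (component A k)\<lparr>carrier := cycles A k\<rparr>"

lemma homology_ring_simps [simp]:
  "component (homology_ring A) = homology A"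
  "gunit (homology_ring A) = homology_class A 0 (gunit A)"
  by (simp_all add: homology_ring_def)

section \<open>Cycles, boundaries and the induced product\<close>

context dga
begin

lemma group_component: "group (component A k)"
  using comm_group_component by (simp add: comm_group_def)

lemma group_hom_diff: "group_hom (component A k) (component A (k - 1)) (diff A k)"
  using diff_hom group_component by (simp add: group_hom_def group_hom_axioms_def)

lemma gmult_one_right:
  "x \<in> carrier (component A p) \<Longrightarrow> gmult A p q x \<one>\<^bsub>component A q\<^esub> = \<one>\<^bsub>component A (p + q)\<^esub>"
  using gmult_hom_right hom_one group_component by blast

lemma gmult_one_left:
  "y \<in> carrier (component A q) \<Longrightarrow> gmult A p q \<one>\<^bsub>component A p\<^esub> y = \<one>\<^bsub>component A (p + q)\<^esub>"
  using hom_one[OF gmult_hom_left] group_component by blast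

lemma gmult_closed:
  "\<lbrakk>x \<in> carrier (component A p); y \<in> carrier (component A q)\<rbrakk>
    \<Longrightarrow> gmult A p q x y \<in> carrier (component A (p + q))"
  using gmult_hom_right by (rule hom_in_carrier)

lemma diff_closed: "x \<in> carrier (component A k) \<Longrightarrow> diff A k x \<in> carrier (component A (k - 1))"
  using diff_hom by (rule hom_in_carrier)

lemma cycles_iff:
  "z \<in> cycles A k \<longleftrightarrow> z \<in> carrier (component A k) \<and> diff A k z = \<one>\<^bsub>component A (k - 1)\<^esub>"
  by (simp add: cycles_def kernel_def)

lemma cycles_closed: "z \<in> cycles A k \<Longrightarrow> z \<in> carrier (component A k)"
  by (simp add: cycles_iff)

lemma subgroup_cycles: "subgroup (cycles A k) (component A k)"
  unfolding cycles_def using group_hom_diff by (rule group_hom.subgroup_kernel)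

lemma boundaries_subset_cycles: "boundaries A k \<subseteq> cycles A k"
proof
  fix z assume "z \<in> boundaries A k"
  then obtain a where a: "a \<in> carrier (component A (k + 1))" "z = diff A (k + 1) a"
    by (auto simp: boundaries_def)
  show "z \<in> cycles A k"
    using diff_closed[OF a(1)] diff_diff[OF a(1)] a(2) by (simp add: cycles_iff)
qed

lemma subgroup_boundaries: "subgroup (boundaries A k) (component A k)"
proof -
  have "group_hom (component A (k + 1)) (component A k) (diff A (k + 1))"
    using group_hom_diff[of "k + 1"] by simp
  then show ?thesis
    unfolding boundaries_def
    by (rule group_hom.subgroup_img_is_subgroup[OF _ group.subgroup_self[OF group_component]])
qed

lemma comm_group_cycle_group: "comm_group (cycle_group A k)"
proof -
  interpret comm_group "component A k" by (rule comm_group_component)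
  have "group (cycle_group A k)"
    using subgroup_imp_group[OF subgroup_cycles] .
  then show ?thesis
    by (rule group.group_comm_groupI) (use cycles_iff in \<open>auto intro: m_comm\<close>)
qed

lemma group_cycle_group: "group (cycle_group A k)"
  using comm_group_cycle_group by (simp add: comm_group_def)

lemma normal_boundaries: "boundaries A k \<lhd> cycle_group A k"
proof (rule comm_group.subgroup_imp_normal[OF comm_group_cycle_group])
  show "subgroup (boundaries A k) (cycle_group A k)"
    by (rule group.subgroup_incl[OF group_component subgroup_boundaries subgroup_cycles
        boundaries_subset_cycles])
qed

lemma group_homology: "group (homology A k)"
  unfolding homology_def using normal_boundaries by (rule normal.factorgroup_is_group)

lemma homology_class_eq_coset: "homology_class A k z = boundaries A k #>\<^bsub>cycle_group A k\<^esub> z"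
  by (simp add: homology_class_def r_coset_def)

lemma carrier_homology: "carrier (homology A k) = homology_class A k ` cycles A k"
  by (simp add: homology_def carrier_FactGroup homology_class_eq_coset[abs_def])

lemma homology_class_hom: "homology_class A k \<in> hom (cycle_group A k) (homology A k)"
  unfolding homology_def homology_class_eq_coset[abs_def]
  using normal_boundaries by (rule normal.r_coset_hom_Mod)

lemma one_homology: "\<one>\<^bsub>homology A k\<^esub> = boundaries A k"
  by (simp add: homology_def)

lemma homology_class_mult:
  "\<lbrakk>x \<in> cycles A k; y \<in> cycles A k\<rbrakk> \<Longrightarrow>
    homology_class A k (x \<otimes>\<^bsub>component A k\<^esub> y) = homology_class A k x \<otimes>\<^bsub>homology A k\<^esub> homology_class A k y"
  using hom_mult[OF homology_class_hom, of x k y] by simp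

lemma homology_class_eq_boundaries_iff:
  assumes "z \<in> cycles A k"
  shows "homology_class A k z = boundaries A k \<longleftrightarrow> z \<in> boundaries A k"
  using assms group.coset_join1[OF group_component _ cycles_closed subgroup_boundaries]
    group.coset_join2[OF group_component cycles_closed subgroup_boundaries]
  unfolding homology_class_def by blast

lemma homology_class_boundary_mult:
  assumes "b \<in> boundaries A k" "z \<in> cycles A k"
  shows "homology_class A k (b \<otimes>\<^bsub>component A k\<^esub> z) = homology_class A k z"
proof -
  have b: "b \<in> cycles A k"
    using assms(1) boundaries_subset_cycles by blast
  then have "homology_class A k b = \<one>\<^bsub>homology A k\<^esub>"
    using assms(1) by (simp add: one_homology homology_class_eq_boundaries_iff)
  moreover have "homology_class A k z \<in> carrier (homology A k)"
    using assms(2) by (simp add: carrier_homology)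
  ultimately show ?thesis
    using homology_class_mult[OF b assms(2)] group.is_monoid[OF group_homology]
    by (simp add: monoid.l_one)
qed

lemma mem_homology_class_iff:
  assumes "z \<in> cycles A k"
  shows "x \<in> homology_class A k z \<longleftrightarrow> x \<in> cycles A k \<and> homology_class A k x = homology_class A k z"
proof
  assume "x \<in> homology_class A k z"
  then obtain b where b: "b \<in> boundaries A k" "x = b \<otimes>\<^bsub>component A k\<^esub> z"
    by (auto simp: homology_class_def r_coset_def)
  then have "x \<in> cycles A k"
    using subgroup.m_closed[OF subgroup_cycles] boundaries_subset_cycles assms by blast
  with b show "x \<in> cycles A k \<and> homology_class A k x = homology_class A k z"
    using homology_class_boundary_mult assms by simp
next
  assume "x \<in> cycles A k \<and> homology_class A k x = homology_class A k z"
  then show "x \<in> homology_class A k z"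
    using group.rcos_self[OF group_component cycles_closed subgroup_boundaries]
    unfolding homology_class_def by blast
qed

lemma homology_class_self: "z \<in> cycles A k \<Longrightarrow> z \<in> homology_class A k z"
  by (simp add: mem_homology_class_iff)

lemma gmult_cycles:
  assumes "x \<in> cycles A p" "y \<in> cycles A q"
  shows "gmult A p q x y \<in> cycles A (p + q)"
proof -
  have xy: "x \<in> carrier (component A p)" "y \<in> carrier (component A q)"
    using assms by (simp_all add: cycles_closed)
  have "gmult A (p - 1) q (diff A p x) y = \<one>\<^bsub>component A (p + q - 1)\<^esub>"
    using assms gmult_one_left[OF xy(2), of "p - 1"] by (simp add: cycles_iff algebra_simps)
  moreover have "gmult A p (q - 1) x (diff A q y) = \<one>\<^bsub>component A (p + q - 1)\<^esub>"
    using assms gmult_one_right[OF xy(1), of "q - 1"] by (simp add: cycles_iff algebra_simps)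
  ultimately show ?thesis
    using leibniz[OF xy] gmult_closed[OF xy] group_component[of "p + q - 1"]
    by (simp add: cycles_iff group.is_monoid monoid.l_one monoid.inv_one)
qed

lemma gmult_boundary_left:
  assumes "x \<in> boundaries A p" "y \<in> cycles A q"
  shows "gmult A p q x y \<in> boundaries A (p + q)"
proof -
  obtain a where a: "a \<in> carrier (component A (p + 1))" "x = diff A (p + 1) a"
    using assms(1) by (auto simp: boundaries_def)
  have y: "y \<in> carrier (component A q)" "diff A q y = \<one>\<^bsub>component A (q - 1)\<^esub>"
    using assms(2) by (simp_all add: cycles_iff)
  interpret group "component A (p + q)" by (rule group_component)
  have "gmult A p q x y \<in> carrier (component A (p + q))"
    using gmult_closed assms boundaries_subset_cycles cycles_closed by blast
  moreover have "gmult A (p + 1) (q - 1) a (diff A q y) = \<one>\<^bsub>component A (p + q)\<^esub>"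
    using gmult_one_right[OF a(1), of "q - 1"] y(2) by simp
  ultimately have "diff A (p + 1 + q) (gmult A (p + 1) q a y) = gmult A p q x y"
    using leibniz[OF a(1) y(1)] a(2) by simp
  moreover have "gmult A (p + 1) q a y \<in> carrier (component A (p + q + 1))"
    using gmult_closed[OF a(1) y(1)] by (simp add: algebra_simps)
  ultimately show ?thesis
    unfolding boundaries_def by (metis add.assoc add.commute image_eqI)
qed

lemma gmult_boundary_right:
  assumes "x \<in> cycles A p" "y \<in> boundaries A q"
  shows "gmult A p q x y \<in> boundaries A (p + q)"
proof -
  obtain a where a: "a \<in> carrier (component A (q + 1))" "y = diff A (q + 1) a"
    using assms(2) by (auto simp: boundaries_def)
  have x: "x \<in> carrier (component A p)" "diff A p x = \<one>\<^bsub>component A (p - 1)\<^esub>"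
    using assms(1) by (simp_all add: cycles_iff)
  interpret group "component A (p + q)" by (rule group_component)
  have xy: "gmult A p q x y \<in> carrier (component A (p + q))"
    using gmult_closed assms boundaries_subset_cycles cycles_closed by blast
  have "gmult A (p - 1) (q + 1) (diff A p x) a = \<one>\<^bsub>component A (p + q)\<^esub>"
    using gmult_one_left[OF a(1), of "p - 1"] x(2) by simp
  then have "diff A (p + q + 1) (gmult A p (q + 1) x a)
      = (if even p then gmult A p q x y else inv\<^bsub>component A (p + q)\<^esub> gmult A p q x y)"
    using leibniz[OF x(1) a(1)] a(2) xy by (auto simp: add.assoc)
  moreover have "gmult A p (q + 1) x a \<in> carrier (component A (p + q + 1))"
    using gmult_closed[OF x(1) a(1)] by (simp add: add.assoc)
  ultimately have "(if even p then gmult A p q x y else inv\<^bsub>component A (p + q)\<^esub> gmult A p q x y)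
      \<in> boundaries A (p + q)"
    unfolding boundaries_def by (metis image_eqI)
  \<comment> \<open>For odd \<open>p\<close> the Leibniz rule gives the inverse of the product;
    boundaries form a subgroup, so inverting once more returns the product.\<close>
  then show ?thesis
    using subgroup.m_inv_closed[OF subgroup_boundaries, of _ "p + q"] inv_inv[OF xy]
    by (metis (full_types))
qed

text \<open>The factors are exchanged one at a time, \<open>x'\<close> for \<open>x\<close> with
  \<open>y'\<close> kept and then \<open>y'\<close> for \<open>y\<close>. Each exchange alters the
  product by a boundary times a cycle or a cycle times a boundary.\<close>

lemma homology_class_gmult_cong:
  assumes "x \<in> cycles A p" "y \<in> cycles A q"
    and "x' \<in> homology_class A p x" "y' \<in> homology_class A q y"
  shows "homology_class A (p + q) (gmult A p q x' y') = homology_class A (p + q) (gmult A p q x y)"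
proof -
  obtain b where b: "b \<in> boundaries A p" "x' = b \<otimes>\<^bsub>component A p\<^esub> x"
    using assms(3) by (auto simp: homology_class_def r_coset_def)
  obtain c where c: "c \<in> boundaries A q" "y' = c \<otimes>\<^bsub>component A q\<^esub> y"
    using assms(4) by (auto simp: homology_class_def r_coset_def)
  have y': "y' \<in> cycles A q"
    using assms mem_homology_class_iff by blast
  have bc: "b \<in> cycles A p" "c \<in> cycles A q"
    using b c boundaries_subset_cycles by blast+
  have "gmult A p q x' y' = gmult A p q b y' \<otimes>\<^bsub>component A (p + q)\<^esub> gmult A p q x y'"
    using hom_mult[OF gmult_hom_left[OF cycles_closed[OF y']] cycles_closed[OF bc(1)] cycles_closed[OF assms(1)]]
      b(2) by simp
  moreover have "gmult A p q x y' = gmult A p q x c \<otimes>\<^bsub>component A (p + q)\<^esub> gmult A p q x y"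
    using hom_mult[OF gmult_hom_right[OF cycles_closed[OF assms(1)]] cycles_closed[OF bc(2)] cycles_closed[OF assms(2)]]
      c(2) by simp
  ultimately show ?thesis
    using homology_class_boundary_mult gmult_cycles gmult_boundary_left[OF b(1) y']
      gmult_boundary_right[OF assms(1) c(1)] assms y' by metis
qed

lemma gmult_homology_ring:
  assumes "x \<in> cycles A p" "y \<in> cycles A q"
  shows "gmult (homology_ring A) p q (homology_class A p x) (homology_class A q y)
    = homology_class A (p + q) (gmult A p q x y)"
proof -
  let ?S = "homology_class A p x \<times> homology_class A q y"
  have "(\<lambda>(x, y). homology_class A (p + q) (gmult A p q x y)) ` ?S
      = (\<lambda>_. homology_class A (p + q) (gmult A p q x y)) ` ?S"
    using homology_class_gmult_cong[OF assms] by (intro image_cong) auto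
  also have "\<dots> = {homology_class A (p + q) (gmult A p q x y)}"
    using homology_class_self[OF assms(1)] homology_class_self[OF assms(2)] by auto
  finally have "(\<lambda>(x, y). homology_class A (p + q) (gmult A p q x y)) ` ?S
      = {homology_class A (p + q) (gmult A p q x y)}" .
  then show ?thesis
    by (simp add: homology_ring_def)
qed

text \<open>The Leibniz rule for the unit times itself reads \<open>d 1 = d 1 + d 1\<close>.\<close>

lemma gunit_cycle: "gunit A \<in> cycles A 0"
proof -
  interpret group "component A (- 1)" by (rule group_component)
  let ?d = "diff A 0 (gunit A)"
  have d: "?d \<in> carrier (component A (- 1))"
    using diff_closed[OF gunit_closed] by simp
  have "?d = ?d \<otimes>\<^bsub>component A (- 1)\<^esub> ?d"
    using leibniz[OF gunit_closed gunit_closed] gunit_left[OF gunit_closed] gunit_left gunit_right d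
    by simp
  then show ?thesis
    using d gunit_closed by (simp add: cycles_iff)
qed

end

section \<open>Homology read off from a map on cycles\<close>

definition presents_homology ::
    "('a, 'm) dga_scheme \<Rightarrow> ('b, 'n) graded_ring_scheme \<Rightarrow> (int \<Rightarrow> 'a \<Rightarrow> 'b) \<Rightarrow> bool" where
  "presents_homology A L e \<longleftrightarrow>
    (\<forall>k. e k \<in> hom (cycle_group A k) (component L k) \<and>
         e k ` cycles A k = carrier (component L k) \<and>
         (\<forall>z \<in> cycles A k. e k z = \<one>\<^bsub>component L k\<^esub> \<longleftrightarrow> z \<in> boundaries A k)) \<and>
    (\<forall>p q. \<forall>x \<in> cycles A p. \<forall>y \<in> cycles A q.
       e (p + q) (gmult A p q x y) = gmult L p q (e p x) (e q y)) \<and>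
    e 0 (gunit A) = gunit L"

lemma presents_homologyD:
  assumes "presents_homology A L e"
  shows "e k \<in> hom (cycle_group A k) (component L k)"
    and "e k ` cycles A k = carrier (component L k)"
    and "z \<in> cycles A k \<Longrightarrow> e k z = \<one>\<^bsub>component L k\<^esub> \<longleftrightarrow> z \<in> boundaries A k"
    and "\<lbrakk>x \<in> cycles A p; y \<in> cycles A q\<rbrakk> \<Longrightarrow> e (p + q) (gmult A p q x y) = gmult L p q (e p x) (e q y)"
    and "e 0 (gunit A) = gunit L"
  using assms unfolding presents_homology_def by blast+

text \<open>Composing the isomorphism with the passage from cycles to classes trades a map on cosets
  for a map on cycles, onto and with the boundaries as kernel. The later arguments can then compute
  with elements.\<close>

lemma presents_homology_if_isomorphic:
  assumes "dga A" and L: "\<And>k. group (component L k)"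
    and "graded_ring_isomorphic (homology_ring A) L"
  shows "\<exists>e. presents_homology A L e"
proof -
  interpret dga A by fact
  obtain f where iso: "\<And>k. f k \<in> iso (homology A k) (component L k)"
    and mult: "\<And>p q x y. \<lbrakk>x \<in> carrier (homology A p); y \<in> carrier (homology A q)\<rbrakk> \<Longrightarrow>
      f (p + q) (gmult (homology_ring A) p q x y) = gmult L p q (f p x) (f q y)"
    and unit: "f 0 (homology_class A 0 (gunit A)) = gunit L"
    using assms(3) unfolding graded_ring_isomorphic_def homology_ring_simps by blast
  define e where "e k z = f k (homology_class A k z)" for k z
  have f: "f k \<in> hom (homology A k) (component L k)"
      "bij_betw (f k) (carrier (homology A k)) (carrier (component L k))" for k
    using iso[of k] by (simp_all add: iso_def)
  have "e k \<in> hom (cycle_group A k) (component L k)" for k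
    using hom_compose[OF homology_class_hom f(1)] by (simp add: e_def[abs_def] comp_def)
  moreover have "e k ` cycles A k = carrier (component L k)" for k
    using f(2)[of k] by (auto simp: e_def bij_betw_def carrier_homology)
  moreover have "e k z = \<one>\<^bsub>component L k\<^esub> \<longleftrightarrow> z \<in> boundaries A k" if z: "z \<in> cycles A k" for k z
  proof -
    have "f k \<one>\<^bsub>homology A k\<^esub> = \<one>\<^bsub>component L k\<^esub>"
      using hom_one[OF f(1) group_homology L] .
    moreover have "homology_class A k z \<in> carrier (homology A k)"
      using z by (simp add: carrier_homology)
    ultimately have "e k z = \<one>\<^bsub>component L k\<^esub> \<longleftrightarrow> homology_class A k z = \<one>\<^bsub>homology A k\<^esub>"
      unfolding e_def using f(2)[of k] group.is_monoid[OF group_homology, of k]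
      by (metis bij_betw_def inj_on_eq_iff monoid.one_closed)
    then show ?thesis
      using homology_class_eq_boundaries_iff[OF z] by (simp add: one_homology)
  qed
  moreover have "e (p + q) (gmult A p q x y) = gmult L p q (e p x) (e q y)"
    if "x \<in> cycles A p" "y \<in> cycles A q" for p q x y
    using mult[of "homology_class A p x" p "homology_class A q y" q] gmult_homology_ring[OF that] that
    by (simp add: e_def carrier_homology)
  ultimately have "presents_homology A L e"
    unfolding presents_homology_def using unit e_def by auto
  then show "\<exists>e. presents_homology A L e" by blast
qed

locale homology_presentation = dga A
  for A :: "('a, 'm) dga_scheme" +
  fixes L :: "('b, 'n) graded_ring_scheme" and e :: "int \<Rightarrow> 'a \<Rightarrow> 'b"
  assumes group_L: "group (component L k)"
    and presents: "presents_homology A L e"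
begin

text \<open>The difference of the two cycles is a boundary exactly when \<open>e k\<close> kills
  it.\<close>

lemma homology_class_eq_iff:
  assumes "x \<in> cycles A k" "y \<in> cycles A k"
  shows "homology_class A k x = homology_class A k y \<longleftrightarrow> e k x = e k y"
proof -
  interpret Z: group_hom "cycle_group A k" "component L k" "e k"
    using presents_homologyD(1)[OF presents] group_cycle_group group_L
    by (simp add: group_hom_def group_hom_axioms_def)
  interpret H: group_hom "cycle_group A k" "homology A k" "homology_class A k"
    using homology_class_hom group_cycle_group group_homology
    by (simp add: group_hom_def group_hom_axioms_def)
  let ?z = "x \<otimes>\<^bsub>cycle_group A k\<^esub> inv\<^bsub>cycle_group A k\<^esub> y"
  have xy: "x \<in> carrier (cycle_group A k)" "y \<in> carrier (cycle_group A k)"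
    using assms by simp_all
  have z: "?z \<in> cycles A k"
    using Z.G.m_closed[OF xy(1) Z.G.inv_closed[OF xy(2)]] by simp
  have "homology_class A k x = homology_class A k y
      \<longleftrightarrow> homology_class A k ?z = \<one>\<^bsub>homology A k\<^esub>"
    using xy Z.G.inv_closed[OF xy(2)] H.hom_mult[of x "inv\<^bsub>cycle_group A k\<^esub> y"] H.hom_inv[OF xy(2)]
      H.H.inv_solve_right'[of "\<one>\<^bsub>homology A k\<^esub>"] H.hom_closed
    by (metis H.H.l_one H.H.one_closed)
  also have "\<dots> \<longleftrightarrow> e k ?z = \<one>\<^bsub>component L k\<^esub>"
    using homology_class_eq_boundaries_iff[OF z] presents_homologyD(3)[OF presents z]
    by (simp add: one_homology)
  also have "\<dots> \<longleftrightarrow> e k x = e k y"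
    using xy Z.G.inv_closed[OF xy(2)] Z.hom_mult[of x "inv\<^bsub>cycle_group A k\<^esub> y"] Z.hom_inv[OF xy(2)]
      Z.H.inv_solve_right'[of "\<one>\<^bsub>component L k\<^esub>"] Z.hom_closed
    by (metis Z.H.l_one Z.H.one_closed)
  finally show ?thesis .
qed

lemma isomorphic_if_presents: "graded_ring_isomorphic (homology_ring A) L"
proof -
  define f where "f k C = the_elem (e k ` C)" for k C
  have f: "f k (homology_class A k z) = e k z" if "z \<in> cycles A k" for k z
  proof -
    \<comment> \<open>\<open>e k\<close> is constant on a homology class, so \<open>the_elem\<close>
      meets a singleton.\<close>
    have "e k ` homology_class A k z = {e k z}"
      using that by (auto simp: mem_homology_class_iff homology_class_eq_iff)
    then show ?thesis by (simp add: f_def)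
  qed
  have "f k \<in> iso (homology A k) (component L k)" for k
  proof -
    have "f k ` carrier (homology A k) = carrier (component L k)"
      using presents_homologyD(2)[OF presents, of k] by (simp add: carrier_homology image_image f)
    moreover have "inj_on (f k) (carrier (homology A k))"
      using f homology_class_eq_iff by (auto simp: carrier_homology inj_on_def)
    moreover have "f k (x \<otimes>\<^bsub>homology A k\<^esub> y) = f k x \<otimes>\<^bsub>component L k\<^esub> f k y"
      if xy: "x \<in> carrier (homology A k)" "y \<in> carrier (homology A k)" for x y
    proof -
      obtain z w where zw: "z \<in> cycles A k" "w \<in> cycles A k"
        "x = homology_class A k z" "y = homology_class A k w"
        using xy by (auto simp: carrier_homology)
      then show ?thesis
        using f[of "z \<otimes>\<^bsub>component A k\<^esub> w" k] subgroup.m_closed[OF subgroup_cycles zw(1,2)]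
          hom_mult[OF presents_homologyD(1)[OF presents, of k], of z w]
        by (simp add: f homology_class_mult)
    qed
    ultimately show ?thesis
      by (auto simp: iso_def bij_betw_def hom_def)
  qed
  moreover have "f (p + q) (gmult (homology_ring A) p q x y) = gmult L p q (f p x) (f q y)"
    if "x \<in> carrier (homology A p)" "y \<in> carrier (homology A q)" for p q x y
    using that
    by (auto simp: carrier_homology gmult_homology_ring f gmult_cycles presents_homologyD(4)[OF presents])
  moreover have "f 0 (homology_class A 0 (gunit A)) = gunit L"
    using f[OF gunit_cycle] presents_homologyD(5)[OF presents] by simp
  ultimately show ?thesis
    unfolding graded_ring_isomorphic_def by (intro exI[of _ f]) simp
qed

end

section \<open>Morphisms that respect the presentations\<close>

lemma dga_hom_cycles:
  assumes "dga A" "dga B" "f \<in> dga_hom A B" "z \<in> cycles A k"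
  shows "f k z \<in> cycles B k"
proof -
  interpret A: dga A by fact
  interpret B: dga B by fact
  have z: "z \<in> carrier (component A k)" "diff A k z = \<one>\<^bsub>component A (k - 1)\<^esub>"
    using assms(4) by (simp_all add: A.cycles_iff)
  have f: "f j \<in> hom (component A j) (component B j)" for j
    using assms(3) by (simp add: dga_hom_def)
  have "diff B k (f k z) = f (k - 1) (diff A k z)"
    using assms(3) z(1) by (simp add: dga_hom_def)
  then show ?thesis
    using hom_in_carrier[OF f z(1)] z(2) hom_one[OF f A.group_component B.group_component]
    by (simp add: B.cycles_iff)
qed

text \<open>Once both homologies are identified with \<open>L\<close>, \<open>compat\<close> says
  that \<open>f\<close> induces the identity of \<open>L\<close>. Being an equivalence is thereby
  reduced to an equation on cycles.\<close>

lemma dga_equivalence_if_presents: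
  assumes "homology_presentation A L e" "homology_presentation B L e'"
    and "f \<in> dga_hom A B"
    and compat: "\<And>k z. z \<in> cycles A k \<Longrightarrow> e' k (f k z) = e k z"
  shows "dga_equivalence A B f"
proof -
  interpret A: homology_presentation A L e by fact
  interpret B: homology_presentation B L e' by fact
  have cyc: "f k z \<in> cycles B k" if "z \<in> cycles A k" for k z
    using dga_hom_cycles[OF A.dga_axioms B.dga_axioms assms(3) that] .
  have map: "homology_map B f k (homology_class A k z) = homology_class B k (f k z)"
    if "z \<in> cycles A k" for k z
  proof -
    have "homology_class B k (f k x) = homology_class B k (f k z)" if "x \<in> homology_class A k z" for x
      using that \<open>z \<in> cycles A k\<close>
      by (auto simp: A.mem_homology_class_iff A.homology_class_eq_iff B.homology_class_eq_iff cyc compat)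
    then have "(\<lambda>x. homology_class B k (f k x)) ` homology_class A k z
        = (\<lambda>_. homology_class B k (f k z)) ` homology_class A k z"
      by (rule image_cong[OF refl])
    also have "\<dots> = {homology_class B k (f k z)}"
      using A.homology_class_self[OF that] by auto
    finally have "(\<lambda>x. homology_class B k (f k x)) ` homology_class A k z = {homology_class B k (f k z)}" .
    then show ?thesis by (simp add: homology_map_def)
  qed
  have "homology_map B f k \<in> iso (homology A k) (homology B k)" for k
  proof -
    have "inj_on (homology_map B f k) (carrier (homology A k))"
      by (auto simp: inj_on_def A.carrier_homology map B.homology_class_eq_iff cyc compat
          A.homology_class_eq_iff)
    moreover have "homology_map B f k ` carrier (homology A k) = carrier (homology B k)"
    proof
      show "homology_map B f k ` carrier (homology A k) \<subseteq> carrier (homology B k)"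
        by (auto simp: A.carrier_homology B.carrier_homology map cyc)
      show "carrier (homology B k) \<subseteq> homology_map B f k ` carrier (homology A k)"
      proof
        fix C assume "C \<in> carrier (homology B k)"
        then obtain y where y: "y \<in> cycles B k" "C = homology_class B k y"
          by (auto simp: B.carrier_homology)
        then have "e' k y \<in> e k ` cycles A k"
          using presents_homologyD(2)[OF A.presents, of k] presents_homologyD(2)[OF B.presents, of k]
          by blast
        then obtain z where z: "z \<in> cycles A k" "e k z = e' k y" by auto
        then have "C = homology_map B f k (homology_class A k z)"
          using y by (simp add: map B.homology_class_eq_iff cyc compat)
        then show "C \<in> homology_map B f k ` carrier (homology A k)"
          using z by (auto simp: A.carrier_homology)
      qed
    qed
    moreover have "homology_map B f k (x \<otimes>\<^bsub>homology A k\<^esub> y)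
        = homology_map B f k x \<otimes>\<^bsub>homology B k\<^esub> homology_map B f k y"
      if xy: "x \<in> carrier (homology A k)" "y \<in> carrier (homology A k)" for x y
    proof -
      obtain z w where zw: "z \<in> cycles A k" "w \<in> cycles A k"
        "x = homology_class A k z" "y = homology_class A k w"
        using xy by (auto simp: A.carrier_homology)
      have "f k \<in> hom (component A k) (component B k)"
        using assms(3) by (simp add: dga_hom_def)
      then have "f k (z \<otimes>\<^bsub>component A k\<^esub> w) = f k z \<otimes>\<^bsub>component B k\<^esub> f k w"
        using zw A.cycles_closed hom_mult by metis
      then show ?thesis
        using zw map[OF subgroup.m_closed[OF A.subgroup_cycles zw(1,2)]]
        by (simp add: map B.homology_class_mult cyc flip: A.homology_class_mult)
    qed
    ultimately show ?thesis
      by (auto simp: iso_def bij_betw_def hom_def)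
  qed
  then show ?thesis
    using assms(3) by (simp add: dga_equivalence_def)
qed

section \<open>The homology of the free model\<close>

lemma exterior_algebra_int_simps [simp]:
  "carrier (component (exterior_algebra \<Z> n) k) = {(a, b). (k \<noteq> 0 \<longrightarrow> a = 0) \<and> (k \<noteq> n \<longrightarrow> b = 0)}"
  "x \<otimes>\<^bsub>component (exterior_algebra \<Z> n) k\<^esub> y = (fst x + fst y, snd x + snd y)"
  "\<one>\<^bsub>component (exterior_algebra \<Z> n) k\<^esub> = (0, 0)"
  "gmult (exterior_algebra \<Z> n) p q x y = (fst x * fst y, fst x * snd y + snd x * fst y)"
  "gunit (exterior_algebra \<Z> n) = (1, 0)"
  by (simp_all add: exterior_algebra_def DirProd_def split_beta)

lemma group_exterior_algebra_int: "group (component (exterior_algebra \<Z> n) k)"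
proof (rule groupI)
  fix x assume "x \<in> carrier (component (exterior_algebra \<Z> n) k)"
  then show "\<exists>y \<in> carrier (component (exterior_algebra \<Z> n) k).
      y \<otimes>\<^bsub>component (exterior_algebra \<Z> n) k\<^esub> x = \<one>\<^bsub>component (exterior_algebra \<Z> n) k\<^esub>"
    by (intro bexI[of _ "(- fst x, - snd x)"]) auto
qed auto

definition free_dga :: "int \<Rightarrow> (nat list \<Rightarrow>\<^sub>0 int) dga" where
  "free_dga n =
    \<lparr>component = (\<lambda>k. free_Abelian_group (words n k)),
     gmult = (\<lambda>_ _. (*)),
     gunit = 1,
     diff = (\<lambda>_. free_diff n)\<rparr>"

lemma free_dga_simps [simp]:
  "component (free_dga n) k = free_Abelian_group (words n k)"
  "gmult (free_dga n) p q x y = x * y"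
  "gunit (free_dga n) = 1"
  "diff (free_dga n) k = free_diff n"
  by (simp_all add: free_dga_def)

lemma dga_free_dga: "dga (free_dga n)"
proof (intro dga.intro graded_ring.intro dga_axioms.intro)
  fix k p q :: int and x y :: "nat list \<Rightarrow>\<^sub>0 int"
  show "comm_group (component (free_dga n) k)"
    by (simp add: abelian_free_Abelian_group)
  show "gmult (free_dga n) p q x \<in> hom (component (free_dga n) q) (component (free_dga n) (p + q))"
    if "x \<in> carrier (component (free_dga n) p)"
    using that keys_mult_words[of x n p _ q]
    by (intro homI) (simp_all add: distrib_left)
  show "(\<lambda>x. gmult (free_dga n) p q x y) \<in> hom (component (free_dga n) p) (component (free_dga n) (p + q))"
    if "y \<in> carrier (component (free_dga n) q)"
    using that keys_mult_words[of _ n p y q]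
    by (intro homI) (simp_all add: distrib_right)
  show "gunit (free_dga n) \<in> carrier (component (free_dga n) 0)"
    by (simp add: one_eq_frag_of_Nil keys_frag_of del: single_one)
  show "diff (free_dga n) k \<in> hom (component (free_dga n) k) (component (free_dga n) (k - 1))"
    by (intro homI) (simp_all add: keys_free_diff free_diff_add)
  show "diff (free_dga n) (p + q) (gmult (free_dga n) p q x y) =
      gmult (free_dga n) (p - 1) q (diff (free_dga n) p x) y
        \<otimes>\<^bsub>component (free_dga n) (p + q - 1)\<^esub>
      (if even p then gmult (free_dga n) p (q - 1) x (diff (free_dga n) q y)
       else inv\<^bsub>component (free_dga n) (p + q - 1)\<^esub> gmult (free_dga n) p (q - 1) x (diff (free_dga n) q y))"
    if xy: "x \<in> carrier (component (free_dga n) p)" "y \<in> carrier (component (free_dga n) q)"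
  proof -
    \<comment> \<open>For odd \<open>p\<close> the inverse in \<open>free_Abelian_group\<close> has
      to be turned into negation, which requires membership in the carrier.\<close>
    have "Poly_Mapping.keys (x * free_diff n y) \<subseteq> words n (p + (q - 1))"
      using xy by (intro keys_mult_words keys_free_diff) simp_all
    then show ?thesis
      using xy free_diff_mult[of x n p y] by (simp add: signed_def add_diff_eq)
  qed
qed (simp_all add: mult.assoc free_diff_free_diff)

text \<open>The counit of the cobar-bar construction: the ring map to the exterior algebra that
  sends \<open>[0]\<close> to the generator and every later letter to 0.\<close>

definition exterior_coeffs :: "(nat list \<Rightarrow>\<^sub>0 int) \<Rightarrow> int \<times> int" where
  "exterior_coeffs c = (Poly_Mapping.lookup c [], Poly_Mapping.lookup c [0])"

lemma exterior_coeffs_add: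
  "exterior_coeffs (x + y) = (fst (exterior_coeffs x) + fst (exterior_coeffs y),
     snd (exterior_coeffs x) + snd (exterior_coeffs y))"
  by (simp add: exterior_coeffs_def lookup_add)

lemma lookup_mult_Nil:
  fixes x y :: "'a list \<Rightarrow>\<^sub>0 int"
  shows "Poly_Mapping.lookup (x * y) [] = Poly_Mapping.lookup x [] * Poly_Mapping.lookup y []"
proof -
  have "Poly_Mapping.keys x \<subseteq> UNIV" by simp
  then show ?thesis
  proof (rule additive_eq_on_frag_of[where f = "\<lambda>x. Poly_Mapping.lookup (x * y) []"
        and g = "\<lambda>x. Poly_Mapping.lookup x [] * Poly_Mapping.lookup y []"])
    fix u :: "'a list"
    have "Poly_Mapping.keys y \<subseteq> UNIV" by simp
    then show "Poly_Mapping.lookup (frag_of u * y) []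
        = Poly_Mapping.lookup (frag_of u) [] * Poly_Mapping.lookup y []"
      by (rule additive_eq_on_frag_of[where f = "\<lambda>y. Poly_Mapping.lookup (frag_of u * y) []"
            and g = "\<lambda>y. Poly_Mapping.lookup (frag_of u) [] * Poly_Mapping.lookup y []"])
        (simp_all add: frag_of_mult_frag_of lookup_add algebra_simps)
  qed (simp_all add: lookup_add algebra_simps)
qed

text \<open>A one-letter word factors in two ways only, as \<open>[] @ [k]\<close> and as
  \<open>[k] @ []\<close>.\<close>

lemma lookup_mult_singleton:
  fixes x y :: "'a list \<Rightarrow>\<^sub>0 int"
  shows "Poly_Mapping.lookup (x * y) [k] = Poly_Mapping.lookup x [] * Poly_Mapping.lookup y [k]
     + Poly_Mapping.lookup x [k] * Poly_Mapping.lookup y []"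
proof -
  have "Poly_Mapping.keys x \<subseteq> UNIV" by simp
  then show ?thesis
  proof (rule additive_eq_on_frag_of[where f = "\<lambda>x. Poly_Mapping.lookup (x * y) [k]"
        and g = "\<lambda>x. Poly_Mapping.lookup x [] * Poly_Mapping.lookup y [k] + Poly_Mapping.lookup x [k] * Poly_Mapping.lookup y []"])
    fix u :: "'a list"
    have "Poly_Mapping.keys y \<subseteq> UNIV" by simp
    then show "Poly_Mapping.lookup (frag_of u * y) [k]
        = Poly_Mapping.lookup (frag_of u) [] * Poly_Mapping.lookup y [k]
          + Poly_Mapping.lookup (frag_of u) [k] * Poly_Mapping.lookup y []"
      by (rule additive_eq_on_frag_of[where f = "\<lambda>y. Poly_Mapping.lookup (frag_of u * y) [k]"
            and g = "\<lambda>y. Poly_Mapping.lookup (frag_of u) [] * Poly_Mapping.lookup y [k]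
              + Poly_Mapping.lookup (frag_of u) [k] * Poly_Mapping.lookup y []"])
        (auto simp add: frag_of_mult_frag_of lookup_add algebra_simps append_eq_Cons_conv Cons_eq_append_conv)
  qed (simp_all add: lookup_add algebra_simps)
qed

text \<open>The differential lengthens every word by one letter and kills \<open>[]\<close>, so only
  words with at least two letters occur in its values.\<close>

lemma exterior_coeffs_free_diff: "exterior_coeffs (free_diff n x) = (0, 0)"
proof -
  have letter: "Poly_Mapping.lookup (diff_letter n k) [] = 0" "Poly_Mapping.lookup (diff_letter n k) [i] = 0" for k i
    by (simp_all add: diff_letter_def lookup_sum)
  have word: "Poly_Mapping.lookup (diff_word n w) [] = 0" "Poly_Mapping.lookup (diff_word n w) [0] = 0" for w
    by (induction w) (simp_all add: lookup_add lookup_mult_Nil lookup_mult_singleton letter)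
  have "Poly_Mapping.keys x \<subseteq> UNIV" by simp
  then have "Poly_Mapping.lookup (free_diff n x) [] = 0"
    by (rule additive_eq_on_frag_of[where f = "\<lambda>x. Poly_Mapping.lookup (free_diff n x) []" and g = "\<lambda>_. 0"]) (simp_all add: free_diff_add lookup_add word)
  moreover have "Poly_Mapping.keys x \<subseteq> UNIV" by simp
  then have "Poly_Mapping.lookup (free_diff n x) [0] = 0"
    by (rule additive_eq_on_frag_of[where f = "\<lambda>x. Poly_Mapping.lookup (free_diff n x) [0]" and g = "\<lambda>_. 0"]) (simp_all add: free_diff_add lookup_add word)
  ultimately show ?thesis
    by (simp add: exterior_coeffs_def)
qed

text \<open>The point is the kernel: for a cycle whose two coefficients vanish, the homotopy formula
  reduces to \<open>z = free_diff n (merge n z)\<close>.\<close>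

lemma presents_homology_free_dga:
  "presents_homology (free_dga n) (exterior_algebra \<Z> n) (\<lambda>_. exterior_coeffs)"
proof -
  interpret dga "free_dga n" by (rule dga_free_dga)
  have degree: "exterior_coeffs z \<in> carrier (component (exterior_algebra \<Z> n) k)"
    if "Poly_Mapping.keys z \<subseteq> words n k" for z k
    using that by (auto simp: exterior_coeffs_def letter_degree_def simp flip: not_in_keys_iff_lookup_eq_zero)
  have "exterior_coeffs \<in> hom (cycle_group (free_dga n) k) (component (exterior_algebra \<Z> n) k)" for k
    using degree cycles_closed[of _ k] by (intro homI) (simp_all add: exterior_coeffs_add)
  moreover have "exterior_coeffs ` cycles (free_dga n) k = carrier (component (exterior_algebra \<Z> n) k)" for k
  proof
    show "exterior_coeffs ` cycles (free_dga n) k \<subseteq> carrier (component (exterior_algebra \<Z> n) k)"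
      using degree cycles_closed[of _ k] by (simp add: image_subset_iff del: exterior_algebra_int_simps)
    show "carrier (component (exterior_algebra \<Z> n) k) \<subseteq> exterior_coeffs ` cycles (free_dga n) k"
    proof
      fix p assume "p \<in> carrier (component (exterior_algebra \<Z> n) k)"
      then obtain a b where p: "p = (a, b)" "k \<noteq> 0 \<longrightarrow> a = 0" "k \<noteq> n \<longrightarrow> b = 0" by auto
      let ?c = "frag_cmul a (frag_of []) + frag_cmul b (frag_of [0])"
      have "Poly_Mapping.keys ?c \<subseteq> words n k"
        using p by (intro keys_add_subset) (auto simp: keys_frag_of letter_degree_def)
      moreover have "free_diff n ?c = 0"
        by (simp add: free_diff_def frag_extend_add frag_extend_cmul diff_letter_def)
      moreover have "exterior_coeffs ?c = p"
        using p by (simp add: exterior_coeffs_def lookup_add)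
      ultimately show "p \<in> exterior_coeffs ` cycles (free_dga n) k"
        by (intro image_eqI[of _ _ ?c]) (simp_all add: cycles_iff)
    qed
  qed
  moreover have "exterior_coeffs z = \<one>\<^bsub>component (exterior_algebra \<Z> n) k\<^esub> \<longleftrightarrow> z \<in> boundaries (free_dga n) k"
    if z: "z \<in> cycles (free_dga n) k" for k z
  proof
    assume "exterior_coeffs z = \<one>\<^bsub>component (exterior_algebra \<Z> n) k\<^esub>"
    then have "z = free_diff n (merge n z)"
      using free_diff_merge[of n z] z by (simp add: cycles_iff exterior_coeffs_def)
    moreover have "merge n z \<in> carrier (component (free_dga n) (k + 1))"
      using z keys_merge by (simp add: cycles_iff)
    ultimately show "z \<in> boundaries (free_dga n) k"
      by (auto simp: boundaries_def)
  next
    assume "z \<in> boundaries (free_dga n) k"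
    then show "exterior_coeffs z = \<one>\<^bsub>component (exterior_algebra \<Z> n) k\<^esub>"
      by (auto simp: boundaries_def exterior_coeffs_free_diff)
  qed
  ultimately show ?thesis
    unfolding presents_homology_def
    by (simp add: exterior_coeffs_def lookup_mult_Nil lookup_mult_singleton one_eq_frag_of_Nil
        del: single_one)
qed

section \<open>Copying a DGA along an injection\<close>

definition transport_dga :: "('a \<Rightarrow> 'b) \<Rightarrow> 'a dga \<Rightarrow> 'b dga" where
  "transport_dga i A =
    \<lparr>component = (\<lambda>k. \<lparr>carrier = i ` carrier (component A k),
       mult = (\<lambda>x y. i (the_inv i x \<otimes>\<^bsub>component A k\<^esub> the_inv i y)),
       one = i \<one>\<^bsub>component A k\<^esub>\<rparr>),
     gmult = (\<lambda>p q x y. i (gmult A p q (the_inv i x) (the_inv i y))),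
     gunit = i (gunit A),
     diff = (\<lambda>k x. i (diff A k (the_inv i x)))\<rparr>"

lemma transport_dga_simps [simp]:
  "carrier (component (transport_dga i A) k) = i ` carrier (component A k)"
  "x \<otimes>\<^bsub>component (transport_dga i A) k\<^esub> y = i (the_inv i x \<otimes>\<^bsub>component A k\<^esub> the_inv i y)"
  "\<one>\<^bsub>component (transport_dga i A) k\<^esub> = i \<one>\<^bsub>component A k\<^esub>"
  "gmult (transport_dga i A) p q x y = i (gmult A p q (the_inv i x) (the_inv i y))"
  "gunit (transport_dga i A) = i (gunit A)"
  "diff (transport_dga i A) k x = i (diff A k (the_inv i x))"
  by (simp_all add: transport_dga_def)

context
  fixes i :: "'a \<Rightarrow> 'b" and A :: "'a dga"
  assumes inj: "inj i" and dga: "dga A"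
begin

interpretation A: dga A by (rule dga)

lemma inv_transport [simp]: "the_inv i (i x) = x"
  using inj by (rule the_inv_f_f)

lemma comm_group_transport: "comm_group (component (transport_dga i A) k)"
proof -
  interpret comm_group "component A k" by (rule A.comm_group_component)
  show ?thesis
  proof (rule comm_groupI)
    fix x assume "x \<in> carrier (component (transport_dga i A) k)"
    then obtain a where "a \<in> carrier (component A k)" "x = i a" by auto
    then show "\<exists>y \<in> carrier (component (transport_dga i A) k).
        y \<otimes>\<^bsub>component (transport_dga i A) k\<^esub> x = \<one>\<^bsub>component (transport_dga i A) k\<^esub>"
      by (intro bexI[of _ "i (inv\<^bsub>component A k\<^esub> a)"]) auto
  qed (auto simp: m_ac)
qed

lemma inv_component_transport:
  assumes "x \<in> carrier (component A k)"
  shows "inv\<^bsub>component (transport_dga i A) k\<^esub> (i x) = i (inv\<^bsub>component A k\<^esub> x)"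
proof -
  interpret group "component A k" by (rule A.group_component)
  interpret T: comm_group "component (transport_dga i A) k" by (rule comm_group_transport)
  show ?thesis
    using assms by (intro T.inv_equality) simp_all
qed

lemma dga_transport: "dga (transport_dga i A)"
proof (intro dga.intro graded_ring.intro dga_axioms.intro)
  fix k p q x y
  show "comm_group (component (transport_dga i A) k)"
    by (rule comm_group_transport)
  show "gmult (transport_dga i A) p q x
      \<in> hom (component (transport_dga i A) q) (component (transport_dga i A) (p + q))"
    if "x \<in> carrier (component (transport_dga i A) p)"
    using that hom_mult[OF A.gmult_hom_right] by (intro homI) (auto simp: A.gmult_closed)
  show "(\<lambda>x. gmult (transport_dga i A) p q x y)
      \<in> hom (component (transport_dga i A) p) (component (transport_dga i A) (p + q))"
    if "y \<in> carrier (component (transport_dga i A) q)"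
    using that hom_mult[OF A.gmult_hom_left] by (intro homI) (auto simp: A.gmult_closed)
  show "diff (transport_dga i A) k
      \<in> hom (component (transport_dga i A) k) (component (transport_dga i A) (k - 1))"
    using hom_mult[OF A.diff_hom] by (intro homI) (auto simp: A.diff_closed)
  show "diff (transport_dga i A) (p + q) (gmult (transport_dga i A) p q x y) =
      gmult (transport_dga i A) (p - 1) q (diff (transport_dga i A) p x) y
        \<otimes>\<^bsub>component (transport_dga i A) (p + q - 1)\<^esub>
      (if even p then gmult (transport_dga i A) p (q - 1) x (diff (transport_dga i A) q y)
       else inv\<^bsub>component (transport_dga i A) (p + q - 1)\<^esub>
         gmult (transport_dga i A) p (q - 1) x (diff (transport_dga i A) q y))"
    if xy: "x \<in> carrier (component (transport_dga i A) p)" "y \<in> carrier (component (transport_dga i A) q)"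
  proof -
    obtain a b where ab: "a \<in> carrier (component A p)" "x = i a" "b \<in> carrier (component A q)" "y = i b"
      using xy by auto
    have "gmult A p (q - 1) a (diff A q b) \<in> carrier (component A (p + q - 1))"
      using A.gmult_closed[OF ab(1) A.diff_closed[OF ab(3)]] by (simp add: add_diff_eq)
    then show ?thesis
      using A.leibniz[OF ab(1,3)] ab by (simp add: inv_component_transport)
  qed
qed (auto simp: A.gmult_assoc A.gunit_closed A.gunit_left A.gunit_right A.diff_diff)

lemma cycles_transport: "cycles (transport_dga i A) k = i ` cycles A k"
  by (auto simp: cycles_def kernel_def inj_eq[OF inj])

lemma boundaries_transport: "boundaries (transport_dga i A) k = i ` boundaries A k"
  by (simp add: boundaries_def image_image)

lemma presents_homology_transport:
  assumes "presents_homology A L e"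
  shows "presents_homology (transport_dga i A) L (\<lambda>k. e k \<circ> the_inv i)"
proof -
  have "e k \<circ> the_inv i \<in> hom (cycle_group (transport_dga i A) k) (component L k)" for k
    using hom_mult[OF presents_homologyD(1)[OF assms, of k]]
      hom_in_carrier[OF presents_homologyD(1)[OF assms, of k]]
    by (intro homI) (auto simp: cycles_transport)
  moreover have "(e k \<circ> the_inv i) ` cycles (transport_dga i A) k = carrier (component L k)" for k
    using presents_homologyD(2)[OF assms, of k] by (simp add: cycles_transport image_image)
  ultimately show ?thesis
    using presents_homologyD(3-)[OF assms]
    by (auto simp: presents_homology_def cycles_transport boundaries_transport inj_image_mem_iff[OF inj])
qed

lemma dga_hom_transport:
  assumes "f \<in> dga_hom A B"
  shows "(\<lambda>k. f k \<circ> the_inv i) \<in> dga_hom (transport_dga i A) B"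
proof -
  have f: "f k \<in> hom (component A k) (component B k)" for k
    using assms by (simp add: dga_hom_def)
  have "f k \<circ> the_inv i \<in> hom (component (transport_dga i A) k) (component B k)" for k
    using hom_mult[OF f] hom_in_carrier[OF f] by (intro homI) auto
  then show ?thesis
    using assms by (auto simp: dga_hom_def)
qed

end

section \<open>Ring maps out of the free model\<close>

text \<open>The sum of the \<open>f w\<close> with coefficients from \<open>c\<close>, in
  multiplicative notation. The explicit formula shows that the value depends on \<open>f\<close>
  only at the words of \<open>c\<close>, on which the recursive choice of letters relies.\<close>

definition linear_extension :: "('a, 'm) monoid_scheme \<Rightarrow> ('c \<Rightarrow> 'a) \<Rightarrow> ('c \<Rightarrow>\<^sub>0 int) \<Rightarrow> 'a" where
  "linear_extension G f c =
     finprod G (\<lambda>w. f w [^]\<^bsub>G\<^esub> Poly_Mapping.lookup c w) (Poly_Mapping.keys c)"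

text \<open>Lets \<open>x\<close>, \<open>y\<close> and \<open>x + y\<close> be evaluated over one
  common index set; outside the support the exponent is 0.\<close>

lemma (in comm_group) linear_extension_superset:
  assumes "finite T" "Poly_Mapping.keys c \<subseteq> T" "f ` T \<subseteq> carrier G"
  shows "linear_extension G f c = finprod G (\<lambda>w. f w [^] Poly_Mapping.lookup c w) T"
  unfolding linear_extension_def using assms
  by (intro finprod_mono_neutral_cong_left) (auto simp: in_keys_iff)

lemma (in comm_group) linear_extension_hom:
  assumes "f ` S \<subseteq> carrier G"
  shows "linear_extension G f \<in> hom (free_Abelian_group S) G"
proof (rule homI)
  fix x assume "x \<in> carrier (free_Abelian_group S)"
  then show "linear_extension G f x \<in> carrier G"
    using assms unfolding linear_extension_def by (intro finprod_closed) auto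
next
  fix x y assume xy: "x \<in> carrier (free_Abelian_group S)" "y \<in> carrier (free_Abelian_group S)"
  let ?T = "Poly_Mapping.keys x \<union> Poly_Mapping.keys y"
  have T: "finite ?T" "f ` ?T \<subseteq> carrier G"
    using xy assms by auto
  have f: "f w \<in> carrier G" if "w \<in> ?T" for w
    using T(2) that by blast
  have "linear_extension G f (x + y) = finprod G (\<lambda>w. f w [^] Poly_Mapping.lookup (x + y) w) ?T"
    using T keys_add by (intro linear_extension_superset)
  also have "\<dots> = finprod G (\<lambda>w. f w [^] Poly_Mapping.lookup x w \<otimes> f w [^] Poly_Mapping.lookup y w) ?T"
    using f by (intro finprod_cong') (auto simp: lookup_add int_pow_mult)
  also have "\<dots> = finprod G (\<lambda>w. f w [^] Poly_Mapping.lookup x w) ?T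
      \<otimes> finprod G (\<lambda>w. f w [^] Poly_Mapping.lookup y w) ?T"
    using f by (intro finprod_multf) auto
  also have "\<dots> = linear_extension G f x \<otimes> linear_extension G f y"
    using T linear_extension_superset[of ?T x f] linear_extension_superset[of ?T y f] by simp
  finally show "linear_extension G f (x \<otimes>\<^bsub>free_Abelian_group S\<^esub> y)
      = linear_extension G f x \<otimes> linear_extension G f y"
    by simp
qed

lemma (in comm_group) linear_extension_frag_of [simp]:
  "f w \<in> carrier G \<Longrightarrow> linear_extension G f (frag_of w) = f w"
  by (simp add: linear_extension_def keys_frag_of)

lemma (in comm_group) linear_extension_cong:
  assumes "\<And>w. w \<in> Poly_Mapping.keys c \<Longrightarrow> f w \<in> carrier G \<and> g w = f w"
  shows "linear_extension G f c = linear_extension G g c"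
  unfolding linear_extension_def using assms by (intro finprod_cong') auto

text \<open>The counterpart of \<open>additive_eq_on_frag_of\<close> for targets that are groups
  with a carrier.\<close>

lemma hom_free_Abelian_group_eqI:
  assumes "group G"
    and h: "h \<in> hom (free_Abelian_group S) G" "h' \<in> hom (free_Abelian_group S) G"
    and "\<And>w. w \<in> S \<Longrightarrow> h (frag_of w) = h' (frag_of w)"
    and "Poly_Mapping.keys c \<subseteq> S"
  shows "h c = h' c"
proof -
  interpret h: group_hom "free_Abelian_group S" G h
    using assms by (simp add: group_hom_def group_hom_axioms_def)
  interpret h': group_hom "free_Abelian_group S" G h'
    using assms by (simp add: group_hom_def group_hom_axioms_def)
  \<comment> \<open>The support is carried through the induction because the homomorphism laws hold
    only on the carrier.\<close>
  have "Poly_Mapping.keys c \<subseteq> S \<and> h c = h' c"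
    using assms(5)
  proof (induction rule: frag_induction)
    case zero
    then show ?case using h.hom_one h'.hom_one by simp
  next
    case (one x)
    then show ?case using assms(4) by (simp add: keys_frag_of)
  next
    case (diff a b)
    have "Poly_Mapping.keys (- b) \<subseteq> S" "a - b = a \<otimes>\<^bsub>free_Abelian_group S\<^esub> (- b)"
      using diff by simp_all
    moreover have "h (- b) = h' (- b)"
      using h.hom_inv[of b] h'.hom_inv[of b] diff by simp
    moreover have "Poly_Mapping.keys (a - b) \<subseteq> S"
      using diff keys_diff[of a b] by blast
    ultimately show ?case
      using diff h.hom_mult[of a "- b"] h'.hom_mult[of a "- b"] by simp
  qed
  then show ?thesis ..
qed

section \<open>Evaluating words at chosen elements of a DGA\<close>

fun word_product :: "('a, 'm) dga_scheme \<Rightarrow> int \<Rightarrow> (nat \<Rightarrow> 'a) \<Rightarrow> nat list \<Rightarrow> 'a" where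
  "word_product B n b [] = gunit B"
| "word_product B n b (k # w) =
     gmult B (letter_degree n k) (word_degree n w) (b k) (word_product B n b w)"

lemma word_product_cong:
  "(\<And>k. k \<in> set w \<Longrightarrow> b k = b' k) \<Longrightarrow> word_product B n b w = word_product B n b' w"
  by (induction w) auto

definition free_ring_map ::
    "('a, 'm) dga_scheme \<Rightarrow> int \<Rightarrow> (nat \<Rightarrow> 'a) \<Rightarrow> int \<Rightarrow> (nat list \<Rightarrow>\<^sub>0 int) \<Rightarrow> 'a" where
  "free_ring_map B n b k = linear_extension (component B k) (word_product B n b)"

locale letters_in_dga = dga B for B :: "('a, 'm) dga_scheme" +
  fixes n :: int and b :: "nat \<Rightarrow> 'a"
  assumes letter_closed: "b j \<in> carrier (component B (letter_degree n j))"
begin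

abbreviation "\<pi> \<equiv> word_product B n b"
abbreviation "\<Phi> \<equiv> free_ring_map B n b"

lemma word_product_closed: "\<pi> w \<in> carrier (component B (word_degree n w))"
  by (induction w) (simp_all add: gunit_closed gmult_closed letter_closed)

lemma word_product_append:
  "\<pi> (u @ v) = gmult B (word_degree n u) (word_degree n v) (\<pi> u) (\<pi> v)"
proof (induction u)
  case Nil
  then show ?case using gunit_left[OF word_product_closed[of v]] by simp
next
  case (Cons k u)
  then show ?case
    using gmult_assoc[OF letter_closed[of k] word_product_closed[of u] word_product_closed[of v]] by simp
qed

lemma free_ring_map_hom: "\<Phi> k \<in> hom (free_Abelian_group (words n k)) (component B k)"
  unfolding free_ring_map_def using word_product_closed
  by (intro comm_group.linear_extension_hom[OF comm_group_component]) auto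

lemma free_ring_map_closed:
  "Poly_Mapping.keys x \<subseteq> words n k \<Longrightarrow> \<Phi> k x \<in> carrier (component B k)"
  using hom_in_carrier[OF free_ring_map_hom] by simp

lemma free_ring_map_frag_of: "word_degree n w = k \<Longrightarrow> \<Phi> k (frag_of w) = \<pi> w"
  unfolding free_ring_map_def using word_product_closed[of w]
  by (simp add: comm_group.linear_extension_frag_of[OF comm_group_component])

lemma free_ring_map_add:
  "\<lbrakk>Poly_Mapping.keys x \<subseteq> words n k; Poly_Mapping.keys y \<subseteq> words n k\<rbrakk>
    \<Longrightarrow> \<Phi> k (x + y) = \<Phi> k x \<otimes>\<^bsub>component B k\<^esub> \<Phi> k y"
  using hom_mult[OF free_ring_map_hom] by simp

lemma free_ring_map_0: "\<Phi> k 0 = \<one>\<^bsub>component B k\<^esub>"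
  using hom_one[OF free_ring_map_hom] group_component by simp

lemma free_ring_map_uminus:
  assumes "Poly_Mapping.keys x \<subseteq> words n k"
  shows "\<Phi> k (- x) = inv\<^bsub>component B k\<^esub> \<Phi> k x"
proof -
  interpret group_hom "free_Abelian_group (words n k)" "component B k" "\<Phi> k"
    using free_ring_map_hom group_component by (simp add: group_hom_def group_hom_axioms_def)
  show ?thesis using hom_inv[of x] assms by simp
qed

text \<open>Compares the maps given by different partial choices of letters, which differ only at
  letters that do not occur in \<open>c\<close>.\<close>

lemma free_ring_map_cong:
  assumes "Poly_Mapping.keys c \<subseteq> words n k"
    and "\<And>w j. \<lbrakk>w \<in> Poly_Mapping.keys c; j \<in> set w\<rbrakk> \<Longrightarrow> b' j = b j"
  shows "free_ring_map B n b' k c = \<Phi> k c"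
proof -
  have "word_product B n b' w = \<pi> w" "\<pi> w \<in> carrier (component B k)" if "w \<in> Poly_Mapping.keys c" for w
    using assms that word_product_closed[of w] by (auto intro: word_product_cong)
  then show ?thesis
    unfolding free_ring_map_def
    by (intro comm_group.linear_extension_cong[OF comm_group_component, symmetric]) simp
qed

lemma free_ring_map_mult:
  assumes x: "Poly_Mapping.keys x \<subseteq> words n p" and y: "Poly_Mapping.keys y \<subseteq> words n q"
  shows "\<Phi> (p + q) (x * y) = gmult B p q (\<Phi> p x) (\<Phi> q y)"
proof -
  have homs: "(\<lambda>y. \<Phi> (p + q) (x * y)) \<in> hom (free_Abelian_group (words n q)) (component B (p + q))"
    if "Poly_Mapping.keys x \<subseteq> words n p" for x
    using that keys_mult_words[OF that]
    by (intro homI) (simp_all add: free_ring_map_closed free_ring_map_add distrib_left)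
  have word: "\<Phi> (p + q) (frag_of u * y) = gmult B p q (\<Phi> p (frag_of u)) (\<Phi> q y)"
    if u: "u \<in> words n p" for u
  proof (rule hom_free_Abelian_group_eqI[OF group_component _ _ _ y])
    show "(\<lambda>y. \<Phi> (p + q) (frag_of u * y)) \<in> hom (free_Abelian_group (words n q)) (component B (p + q))"
      using u by (intro homs) (simp add: keys_frag_of)
    have "\<Phi> p (frag_of u) \<in> carrier (component B p)"
      using u by (intro free_ring_map_closed) (simp add: keys_frag_of)
    from hom_compose[OF free_ring_map_hom gmult_hom_right[OF this]]
    show "(\<lambda>y. gmult B p q (\<Phi> p (frag_of u)) (\<Phi> q y))
        \<in> hom (free_Abelian_group (words n q)) (component B (p + q))"
      by (simp add: comp_def)
    show "\<Phi> (p + q) (frag_of u * frag_of v) = gmult B p q (\<Phi> p (frag_of u)) (\<Phi> q (frag_of v))"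
      if "v \<in> words n q" for v
      using u that word_product_append[of u v] by (simp add: frag_of_mult_frag_of free_ring_map_frag_of)
  qed
  show ?thesis
  proof (rule hom_free_Abelian_group_eqI[OF group_component _ _ _ x])
    show "\<Phi> (p + q) (frag_of u * y) = gmult B p q (\<Phi> p (frag_of u)) (\<Phi> q y)"
      if "u \<in> words n p" for u
      using that by (rule word)
    show "(\<lambda>x. \<Phi> (p + q) (x * y)) \<in> hom (free_Abelian_group (words n p)) (component B (p + q))"
      using keys_mult_words[OF _ y]
      by (intro homI) (simp_all add: free_ring_map_closed free_ring_map_add distrib_right)
    from hom_compose[OF free_ring_map_hom gmult_hom_left[OF free_ring_map_closed[OF y]]]
    show "(\<lambda>x. gmult B p q (\<Phi> p x) (\<Phi> q y)) \<in> hom (free_Abelian_group (words n p)) (component B (p + q))"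
      by (simp add: comp_def)
  qed
qed

text \<open>The hypothesis concerns the letters of \<open>w\<close> alone: while letters are being
  chosen, compatibility with the differential is known only for the earlier ones.\<close>

lemma diff_word_product:
  assumes "\<And>k. k \<in> set w \<Longrightarrow> diff B (letter_degree n k) (b k) = \<Phi> (letter_degree n k - 1) (diff_letter n k)"
  shows "diff B (word_degree n w) (\<pi> w) = \<Phi> (word_degree n w - 1) (diff_word n w)"
  using assms
proof (induction w)
  case Nil
  then show ?case using gunit_cycle by (simp add: cycles_iff free_ring_map_0)
next
  case (Cons k w)
  define p q where "p = letter_degree n k" and "q = word_degree n w"
  have kw: "Poly_Mapping.keys (frag_of [k]) \<subseteq> words n p" "Poly_Mapping.keys (frag_of w) \<subseteq> words n q"
    by (simp_all add: keys_frag_of p_def q_def)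
  have dk: "Poly_Mapping.keys (diff_letter n k) \<subseteq> words n (p - 1)"
    and dw: "Poly_Mapping.keys (diff_word n w) \<subseteq> words n (q - 1)"
    unfolding p_def q_def by (rule keys_diff_letter, rule keys_diff_word)
  have b: "\<Phi> p (frag_of [k]) = b k"
    using gunit_right[OF letter_closed[of k]] by (simp add: free_ring_map_frag_of p_def)
  have "\<Phi> (p - 1 + q) (diff_letter n k * frag_of w)
      = gmult B (p - 1) q (diff B p (b k)) (\<pi> w)"
    using free_ring_map_mult[OF dk kw(2)] Cons.prems by (simp add: p_def q_def free_ring_map_frag_of)
  moreover have "\<Phi> (p + (q - 1)) (frag_of [k] * diff_word n w)
      = gmult B p (q - 1) (b k) (diff B q (\<pi> w))"
    using free_ring_map_mult[OF kw(1) dw] Cons b by (simp add: p_def q_def)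
  moreover have "Poly_Mapping.keys (diff_letter n k * frag_of w) \<subseteq> words n (p + q - 1)"
    "Poly_Mapping.keys (frag_of [k] * diff_word n w) \<subseteq> words n (p + q - 1)"
    using keys_mult_words[OF dk kw(2)] keys_mult_words[OF kw(1) dw] by (simp_all add: algebra_simps)
  ultimately have "\<Phi> (p + q - 1) (diff_word n (k # w))
      = gmult B (p - 1) q (diff B p (b k)) (\<pi> w) \<otimes>\<^bsub>component B (p + q - 1)\<^esub>
        (if even p then gmult B p (q - 1) (b k) (diff B q (\<pi> w))
         else inv\<^bsub>component B (p + q - 1)\<^esub> gmult B p (q - 1) (b k) (diff B q (\<pi> w)))"
    by (simp add: signed_def free_ring_map_add free_ring_map_uminus diff_add_eq add_diff_eq
        flip: p_def)
  then show ?case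
    using leibniz[OF letter_closed[of k] word_product_closed[of w]] by (simp add: p_def q_def)
qed

lemma diff_free_ring_map:
  assumes "\<And>w k. \<lbrakk>w \<in> Poly_Mapping.keys x; k \<in> set w\<rbrakk>
      \<Longrightarrow> diff B (letter_degree n k) (b k) = \<Phi> (letter_degree n k - 1) (diff_letter n k)"
    and x: "Poly_Mapping.keys x \<subseteq> words n p"
  shows "diff B p (\<Phi> p x) = \<Phi> (p - 1) (free_diff n x)"
proof -
  \<comment> \<open>Only the words of \<open>x\<close> serve as generators, since the hypothesis
    says nothing about other letters.\<close>
  let ?S = "Poly_Mapping.keys x"
  have sub: "Poly_Mapping.keys c \<subseteq> words n p" if "Poly_Mapping.keys c \<subseteq> ?S" for c
    using that x by blast
  have \<Phi>: "\<Phi> p \<in> hom (free_Abelian_group ?S) (component B p)"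
    by (intro homI) (simp_all add: free_ring_map_closed free_ring_map_add sub)
  show ?thesis
  proof (rule hom_free_Abelian_group_eqI[where h = "\<lambda>x. diff B p (\<Phi> p x)"
        and h' = "\<lambda>x. \<Phi> (p - 1) (free_diff n x)", OF group_component _ _ _ subset_refl])
    show "(\<lambda>x. diff B p (\<Phi> p x)) \<in> hom (free_Abelian_group ?S) (component B (p - 1))"
      using hom_compose[OF \<Phi> diff_hom] by (simp add: comp_def)
    show "(\<lambda>x. \<Phi> (p - 1) (free_diff n x)) \<in> hom (free_Abelian_group ?S) (component B (p - 1))"
      by (intro homI)
        (simp_all add: free_ring_map_closed free_ring_map_add free_diff_add keys_free_diff sub)
    show "diff B p (\<Phi> p (frag_of w)) = \<Phi> (p - 1) (free_diff n (frag_of w))" if "w \<in> ?S" for w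
      using that x assms(1)[OF that] diff_word_product[of w] by (auto simp: free_ring_map_frag_of)
  qed
qed

lemma free_ring_map_dga_hom:
  assumes "\<And>k. diff B (letter_degree n k) (b k) = \<Phi> (letter_degree n k - 1) (diff_letter n k)"
  shows "\<Phi> \<in> dga_hom (free_dga n) B"
proof -
  have "\<Phi> 0 1 = gunit B"
    by (simp add: one_eq_frag_of_Nil free_ring_map_frag_of del: single_one)
  then show ?thesis
    using free_ring_map_hom diff_free_ring_map assms free_ring_map_mult by (simp add: dga_hom_def)
qed

end

text \<open>This is what makes the choice of letters a well-founded recursion.\<close>

lemma keys_diff_letter_letters:
  assumes "w \<in> Poly_Mapping.keys (diff_letter n k)" "j \<in> set w"
  shows "j < k"
proof -
  have "Poly_Mapping.keys (diff_letter n k)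
      \<subseteq> (\<Union>i<k. Poly_Mapping.keys (signed (letter_degree n i + 1) (frag_of [i, k - 1 - i])))"
    unfolding diff_letter_def by (rule keys_sum)
  then obtain i where "i < k" "w = [i, k - 1 - i]"
    using assms(1) by (auto simp: keys_frag_of)
  then show ?thesis
    using assms(2) by auto
qed

section \<open>Choosing the images of the letters\<close>

context homology_presentation
begin

lemma boundary_if_coeff_one:
  assumes "z \<in> cycles A k" "e k z = \<one>\<^bsub>component L k\<^esub>"
  obtains a where "a \<in> carrier (component A (k + 1))" "diff A (k + 1) a = z"
  using presents_homologyD(3)[OF presents assms(1)] assms(2) by (auto simp: boundaries_def)

end

text \<open>Obstruction theory, one letter at a time. The value \<open>z\<close> prescribed for the
  differential of letter \<open>k\<close> is a cycle in degree \<open>letter_degree n k - 1\<close>,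
  and the letter can be chosen exactly when \<open>z\<close> bounds.\<close>

lemma exists_letters:
  fixes B :: "('a, 'm) dga_scheme"
  assumes "homology_presentation B (exterior_algebra \<Z> n) e"
    and x: "x \<in> cycles B n" "e n x = (0, 1)"
  shows "\<exists>b. letters_in_dga B n b \<and> b 0 = x \<and>
    (\<forall>k. diff B (letter_degree n k) (b k) = free_ring_map B n b (letter_degree n k - 1) (diff_letter n k))"
proof -
  interpret homology_presentation B "exterior_algebra \<Z> n" e by fact
  have degree_0: "letter_degree n 0 = n"
    by (simp add: letter_degree_def)
  \<comment> \<open>\<open>dependent_wf_choice\<close> requires the condition on \<open>b k\<close> to depend on \<open>b\<close> only below \<open>k\<close>.\<close>
  define cut where
    "cut b k j = (if j < k then b j else \<one>\<^bsub>component B (letter_degree n j)\<^esub>)" for b and k j :: nat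
  define P where "P b k r \<longleftrightarrow> r \<in> carrier (component B (letter_degree n k)) \<and> (k = 0 \<longrightarrow> r = x) \<and>
    diff B (letter_degree n k) r = free_ring_map B n (cut b k) (letter_degree n k - 1) (diff_letter n k)"
    for b k r
  have "\<exists>b. \<forall>k. P b k (b k)"
  proof (rule dependent_wf_choice[OF wf_less_than])
    fix f g :: "nat \<Rightarrow> 'a" and k r
    assume "\<And>z. (z, k) \<in> less_than \<Longrightarrow> f z = g z"
    then have "cut f k = cut g k"
      by (auto simp: cut_def)
    then show "P f k r = P g k r"
      by (simp add: P_def)
  next
    fix k b
    assume IH: "\<And>j. (j, k) \<in> less_than \<Longrightarrow> P b j (b j)"
    define c where "c = cut b k"
    \<comment> \<open>The letters from \<open>k\<close> on are the zero of their degree, so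
      \<open>c\<close> is a complete assignment and defines a ring map
      \<open>\<Phi>\<close>.\<close>
    interpret letters_in_dga B n c
    proof
      show "c j \<in> carrier (component B (letter_degree n j))" for j
        using IH[of j] group.is_monoid[OF group_component] by (simp add: c_def cut_def P_def monoid.one_closed)
    qed
    have c: "diff B (letter_degree n j) (c j) = \<Phi> (letter_degree n j - 1) (diff_letter n j)" if "j < k" for j
    proof -
      have "free_ring_map B n (cut b j) (letter_degree n j - 1) (diff_letter n j)
          = \<Phi> (letter_degree n j - 1) (diff_letter n j)"
        using keys_diff_letter_letters that
        by (intro free_ring_map_cong keys_diff_letter) (fastforce simp: c_def cut_def)
      then show ?thesis
        using IH[of j] that by (simp add: P_def c_def cut_def)
    qed
    define z where "z = \<Phi> (letter_degree n k - 1) (diff_letter n k)"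
    \<comment> \<open>All letters of \<open>diff_letter n k\<close> lie below \<open>k\<close>, so
      \<open>\<Phi>\<close> commutes with the differential there, and
      \<open>free_diff_diff_letter\<close> makes the differential of \<open>z\<close>
      vanish.\<close>
    have z: "z \<in> cycles B (letter_degree n k - 1)"
      using diff_free_ring_map[OF _ keys_diff_letter, of k] c keys_diff_letter_letters
        free_ring_map_closed[OF keys_diff_letter]
      by (simp add: z_def cycles_iff free_diff_diff_letter free_ring_map_0)
    show "\<exists>r. P b k r"
    proof (cases "k = 0")
      case True
      then have "P b k x"
        using x(1) free_ring_map_0[of "n - 1"]
        by (simp add: P_def degree_0 cycles_iff c_def diff_letter_def)
      then show ?thesis ..
    next
      case False
      have "e (letter_degree n k - 1) z = \<one>\<^bsub>component (exterior_algebra \<Z> n) (letter_degree n k - 1)\<^esub>"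
      \<comment> \<open>Letters are numbered from 0, so \<open>k = 1\<close> is the letter whose
        differential is the square of \<open>x\<close> up to sign. Its obstruction has degree
        \<open>n + n\<close>, which degrees alone do not exclude when \<open>n = 0\<close>.\<close>
      proof (cases "k = 1")
        case True
        have c0: "c 0 = x"
          using IH[of 0] True by (simp add: P_def c_def cut_def)
        have deg: "letter_degree n k - 1 = n + n"
          using True by (simp add: letter_degree_def)
        have word: "word_product B n c [0, 0] = gmult B n n x x"
          using gunit_right[OF cycles_closed[OF x(1)]] by (simp add: c0 degree_0)
        \<comment> \<open>In the exterior algebra \<open>(0, 1)\<close> squares to
          \<open>(0, 0)\<close>; so the square of \<open>x\<close> bounds, though it need not be
          zero.\<close>
        have xx: "gmult B n n x x \<in> boundaries B (n + n)"
          using presents_homologyD(3)[OF presents gmult_cycles[OF x(1) x(1)]]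
            presents_homologyD(4)[OF presents x(1) x(1)] x(2) by simp
        have "z = (if odd n then gmult B n n x x else inv\<^bsub>component B (n + n)\<^esub> gmult B n n x x)"
          unfolding z_def deg using True word
          by (simp add: diff_letter_def signed_def degree_0 free_ring_map_uminus free_ring_map_frag_of keys_frag_of)
        then have "z \<in> boundaries B (n + n)"
          using xx subgroup.m_inv_closed[OF subgroup_boundaries xx] by simp
        then show ?thesis
          using presents_homologyD(3)[OF presents z] deg by simp
      next
        case False
        then have "k \<ge> 2"
          using \<open>k \<noteq> 0\<close> by simp
        \<comment> \<open>Degree 0 would make \<open>k + 1\<close>, at least 3, a divisor of 2;
          degree \<open>n\<close> would make \<open>k\<close>, at least 2, a divisor of 1. In all
          other degrees the exterior algebra is trivial.\<close>
        have "letter_degree n k - 1 \<noteq> 0"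
        proof
          assume "letter_degree n k - 1 = 0"
          then have "(int k + 1) * (n + 1) = 2"
            by (simp add: letter_degree_def)
          then have "int k + 1 dvd 2"
            by (metis dvd_triv_left)
          then show False
            using \<open>k \<ge> 2\<close> zdvd_imp_le[of "int k + 1" 2] by simp
        qed
        moreover have "letter_degree n k - 1 \<noteq> n"
        proof
          assume "letter_degree n k - 1 = n"
          then have "int k * (n + 1) = 1"
            by (simp add: letter_degree_def algebra_simps)
          then have "int k dvd 1"
            by (metis dvd_triv_left)
          then show False
            using \<open>k \<ge> 2\<close> by simp
        qed
        ultimately show ?thesis
          using hom_in_carrier[OF presents_homologyD(1)[OF presents], of z "letter_degree n k - 1"] z
          by auto
      qed
      from boundary_if_coeff_one[OF z this] obtain r
        where "r \<in> carrier (component B (letter_degree n k))" "diff B (letter_degree n k) r = z"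
        by auto
      then have "P b k r"
        using False by (simp add: P_def z_def c_def)
      then show ?thesis ..
    qed
  qed
  then obtain b where b: "\<And>k. P b k (b k)"
    by blast
  interpret letters_in_dga B n b
    by standard (use b in \<open>simp add: P_def\<close>)
  have "free_ring_map B n (cut b k) (letter_degree n k - 1) (diff_letter n k)
      = \<Phi> (letter_degree n k - 1) (diff_letter n k)" for k
    using keys_diff_letter_letters
    by (intro free_ring_map_cong keys_diff_letter) (fastforce simp: cut_def)
  then show ?thesis
    using b letters_in_dga_axioms by (intro exI[of _ b]) (simp add: P_def)
qed

text \<open>Modulo the boundary of \<open>merge n z\<close>, a cycle \<open>z\<close> is a
  combination of \<open>[]\<close> and \<open>[0]\<close>. There the two sides agree, because units
  correspond and \<open>[0]\<close> goes to a cycle \<open>x\<close> with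
  \<open>e n x = (0, 1)\<close>.\<close>

lemma exists_hom_from_free_dga:
  assumes "homology_presentation B (exterior_algebra \<Z> n) e"
  shows "\<exists>f \<in> dga_hom (free_dga n) B. \<forall>k. \<forall>z \<in> cycles (free_dga n) k. e k (f k z) = exterior_coeffs z"
proof -
  interpret homology_presentation B "exterior_algebra \<Z> n" e by fact
  interpret F: dga "free_dga n" by (rule dga_free_dga)
  have "(0, 1) \<in> e n ` cycles B n"
    using presents_homologyD(2)[OF presents, of n] by simp
  then obtain x where x: "x \<in> cycles B n" "e n x = (0, 1)"
    by (metis imageE)
  obtain b where "letters_in_dga B n b" and b0: "b 0 = x" and
    b: "\<And>k. diff B (letter_degree n k) (b k) = free_ring_map B n b (letter_degree n k - 1) (diff_letter n k)"
    using exists_letters[OF assms x] by blast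
  then interpret letters_in_dga B n b by simp
  have hom: "\<Phi> \<in> dga_hom (free_dga n) B"
    using b by (rule free_ring_map_dga_hom)
  have cyc: "\<Phi> k z \<in> cycles B k" if "z \<in> cycles (free_dga n) k" for k z
    using dga_hom_cycles[OF dga_free_dga dga_axioms hom that] .
  note F_presents = presents_homologyD[OF presents_homology_free_dga]
  have "e k (\<Phi> k z) = exterior_coeffs z" if z: "z \<in> cycles (free_dga n) k" for k z
  proof -
    define d where "d = free_diff n (merge n z)"
    \<comment> \<open>Both words survive the intersection only if \<open>k = n = 0\<close>.\<close>
    define S where "S = words n k \<inter> {[], [0]}"
    have zk: "Poly_Mapping.keys z \<subseteq> words n k"
      using F.cycles_closed[OF z] by simp
    have d: "d \<in> boundaries (free_dga n) k"
      using keys_merge[OF zk] by (auto simp: d_def boundaries_def)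
    then have d_cycle: "d \<in> cycles (free_dga n) k"
      using F.boundaries_subset_cycles by blast
    have "z - d = frag_cmul (Poly_Mapping.lookup z []) (frag_of [])
        + frag_cmul (Poly_Mapping.lookup z [0]) (frag_of [0])"
      using free_diff_merge[of n z] z by (simp add: F.cycles_iff d_def algebra_simps)
    moreover have "Poly_Mapping.keys \<dots> \<subseteq> {[], [0]}"
      by (intro keys_add_subset) (auto simp: keys_frag_of)
    moreover have "Poly_Mapping.keys (z - d) \<subseteq> words n k"
      using zk F.cycles_closed[OF d_cycle] keys_diff[of z d] by auto
    ultimately have zd: "Poly_Mapping.keys (z - d) \<subseteq> S"
      by (simp add: S_def)
    have S_cycles: "y \<in> cycles (free_dga n) k" if "Poly_Mapping.keys y \<subseteq> S" for y
    proof -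
      have "free_diff n y = 0"
        using that
        by (rule additive_eq_on_frag_of[where g = "\<lambda>_. 0"])
          (auto simp: S_def free_diff_add diff_letter_def)
      then show ?thesis
        using that by (auto simp: F.cycles_iff S_def)
    qed
    have "e k (\<Phi> k (z - d)) = exterior_coeffs (z - d)"
    proof (rule hom_free_Abelian_group_eqI[where h = "\<lambda>y. e k (\<Phi> k y)" and h' = exterior_coeffs,
          OF group_exterior_algebra_int _ _ _ zd])
      have sub: "Poly_Mapping.keys y \<subseteq> words n k" if "Poly_Mapping.keys y \<subseteq> S" for y
        using that by (auto simp: S_def)
      show "(\<lambda>y. e k (\<Phi> k y)) \<in> hom (free_Abelian_group S) (component (exterior_algebra \<Z> n) k)"
        using hom_mult[OF presents_homologyD(1)[OF presents, of k]] hom_in_carrier[OF presents_homologyD(1)[OF presents, of k]]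
        by (intro homI)
          (simp_all del: exterior_algebra_int_simps add: cyc S_cycles free_ring_map_add sub)
      show "exterior_coeffs \<in> hom (free_Abelian_group S) (component (exterior_algebra \<Z> n) k)"
        using hom_in_carrier[OF F_presents(1)[of n k]]
        by (intro homI) (simp_all del: exterior_algebra_int_simps(1) add: S_cycles exterior_coeffs_add)
      show "e k (\<Phi> k (frag_of w)) = exterior_coeffs (frag_of w)" if "w \<in> S" for w
      proof -
        consider "w = []" "k = 0" | "w = [0]" "k = n"
          using \<open>w \<in> S\<close> by (auto simp: S_def letter_degree_def)
        then show ?thesis
        proof cases
          case 1
          then show ?thesis
            using presents_homologyD(5)[OF presents] by (simp add: free_ring_map_frag_of exterior_coeffs_def)
        next
          case 2
          then have "\<Phi> k (frag_of w) = x"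
            using gunit_right[OF cycles_closed[OF x(1)]]
            by (simp add: free_ring_map_frag_of letter_degree_def b0)
          then show ?thesis
            using 2 x(2) by (simp add: exterior_coeffs_def)
        qed
      qed
    qed
    moreover have "e k (\<Phi> k d) = (0, 0)"
    proof -
      have "\<Phi> (k + 1) (merge n z) \<in> carrier (component B (k + 1))"
        using keys_merge[OF zk] by (rule free_ring_map_closed)
      moreover have "\<Phi> k d = diff B (k + 1) (\<Phi> (k + 1) (merge n z))"
        using diff_free_ring_map[OF b keys_merge[OF zk]] by (simp add: d_def)
      ultimately have "\<Phi> k d \<in> boundaries B k"
        by (auto simp: boundaries_def)
      then show ?thesis
        using presents_homologyD(3)[OF presents cyc[OF d_cycle]] by simp
    qed
    moreover have "e k (\<Phi> k z) = e k (\<Phi> k (z - d)) \<otimes>\<^bsub>component (exterior_algebra \<Z> n) k\<^esub> e k (\<Phi> k d)"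
    proof -
      have "\<Phi> k ((z - d) + d) = \<Phi> k (z - d) \<otimes>\<^bsub>component B k\<^esub> \<Phi> k d"
        using F.cycles_closed[OF S_cycles[OF zd]] F.cycles_closed[OF d_cycle]
        by (intro free_ring_map_add) simp_all
      then show ?thesis
        using hom_mult[OF presents_homologyD(1)[OF presents, of k], of "\<Phi> k (z - d)" "\<Phi> k d"]
          cyc[OF S_cycles[OF zd]] cyc[OF d_cycle] by simp
    qed
    moreover have "exterior_coeffs z = exterior_coeffs (z - d)"
      using exterior_coeffs_add[of "z - d" d] exterior_coeffs_free_diff[of n "merge n z"]
      by (simp add: d_def)
    ultimately show ?thesis
      by simp
  qed
  then show ?thesis
    using hom by blast
qed

text \<open>Uniqueness follows from one object with an equivalence to each of the others: any
  \<open>B\<close> and \<open>B'\<close> are joined by the span \<open>B <- A -> B'\<close>.\<close>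

theorem mainTheorem3:
  fixes n :: int
  assumes "infinite (UNIV :: 'u set)"
  shows "\<exists>A :: 'u dga. dga A \<and> of_type_beta \<Z> n A \<and>
    (\<forall>B :: 'u dga. dga B \<and> of_type_beta \<Z> n B \<longrightarrow> dga_equivalent A B)"
proof -
  \<comment> \<open>The free model is countable: its elements embed into words, words into the
    natural numbers, and these into the infinite type \<open>'u\<close>.\<close>
  have "carrier (free_Abelian_group (UNIV :: nat list set)) \<approx> (UNIV :: nat list set)"
    by (rule eqpoll_free_Abelian_group_infinite) (rule infinite_UNIV_listI)
  moreover have "carrier (free_Abelian_group (UNIV :: nat list set)) = UNIV"
    by auto
  ultimately obtain g :: "(nat list \<Rightarrow>\<^sub>0 int) \<Rightarrow> nat list" where "inj g"
    by (auto simp: eqpoll_def bij_betw_def)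
  moreover obtain h :: "nat \<Rightarrow> 'u" where "inj h"
    using infinite_countable_subset[OF assms] by blast
  ultimately have inj: "inj (h \<circ> to_nat \<circ> g)"
    by (intro inj_compose) simp_all
  define i where "i = h \<circ> to_nat \<circ> g"
  define A where "A = transport_dga i (free_dga n)"
  have i: "inj i"
    using inj by (simp add: i_def)
  have A: "dga A"
    unfolding A_def using i dga_free_dga by (rule dga_transport)
  have "presents_homology A (exterior_algebra \<Z> n) (\<lambda>k. exterior_coeffs \<circ> the_inv i)"
    unfolding A_def by (rule presents_homology_transport[OF i dga_free_dga presents_homology_free_dga])
  with A have A': "homology_presentation A (exterior_algebra \<Z> n) (\<lambda>k. exterior_coeffs \<circ> the_inv i)"
    by (simp add: homology_presentation_def homology_presentation_axioms_def group_exterior_algebra_int)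
  show ?thesis
  proof (intro exI conjI allI impI)
    show "dga A" by (rule A)
    show "of_type_beta \<Z> n A"
      using homology_presentation.isomorphic_if_presents[OF A'] by (simp add: of_type_beta_def)
    fix B :: "'u dga" assume B: "dga B \<and> of_type_beta \<Z> n B"
    then obtain e where "presents_homology B (exterior_algebra \<Z> n) e"
      using presents_homology_if_isomorphic group_exterior_algebra_int unfolding of_type_beta_def by blast
    with B have B': "homology_presentation B (exterior_algebra \<Z> n) e"
      by (simp add: homology_presentation_def homology_presentation_axioms_def group_exterior_algebra_int)
    obtain f where f: "f \<in> dga_hom (free_dga n) B"
      "\<And>k z. z \<in> cycles (free_dga n) k \<Longrightarrow> e k (f k z) = exterior_coeffs z"
      using exists_hom_from_free_dga[OF B'] by blast
    have "dga_equivalence A B (\<lambda>k. f k \<circ> the_inv i)"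
    proof (rule dga_equivalence_if_presents[OF A' B'])
      show "(\<lambda>k. f k \<circ> the_inv i) \<in> dga_hom A B"
        unfolding A_def using i dga_free_dga f(1) by (rule dga_hom_transport)
      show "e k ((f k \<circ> the_inv i) z) = (exterior_coeffs \<circ> the_inv i) z" if "z \<in> cycles A k" for k z
        using that f(2) by (auto simp: A_def cycles_transport[OF i dga_free_dga] the_inv_f_f[OF i])
    qed
    then show "dga_equivalent A B"
      unfolding dga_equivalent_def using A B by (intro r_into_equivclp) blast
  qed
qed

end
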